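(* Let $\beta>1$ be fixed. There exist positive constants $\epsilon_0(\beta)$ and $C(\beta)$, depending only on $\beta$, such that the following holds. Let $A$ be the adjacency matrix of the complete graph on $n$ nodes and let $B$ be the adjacency matrix of a $d$-regular $\epsilon$-expander on $n$ nodes. Let $\mu$ be the Ising model with interaction matrix $\frac{\beta}{n}A$ and $\nu$ the Ising model with interaction matrix $\frac{\beta}{d}B$, and let $\rho^{(k)}[R]$, $\tilde\rho^{(k)}[R]$ denote their respective $k$th order moments. If $\epsilon<\epsilon_0(\beta)$, then for any even positive integer $k<n$, $$\frac{1}{\binom nk}\sum_{\substack{R\subset[n]\\|R|=k}}\big|\rho^{(k)}[R]-\tilde\rho^{(k)}[R]\big|\le k\,C(\beta)\Big(\epsilon+\frac1n\Big).$$ In particular (case $k=2$), with $\rho_{ij}=\mathbb{E}_\mu x^ix^j$ and $\tilde\rho_{ij}=\mathbb{E}_\nu x^ix^j$, $$\frac{1}{\binom n2}\sum_{1\le i<j\le n}|\rho_{ij}-\tilde\rho_{ij}|<2C(\beta)\Big(\epsilon+\frac1n\Big).$$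
   Context: An interaction matrix $J$ is a real symmetric $n\times n$ matrix with zero diagonal. The Ising model with interaction matrix $J$ is the probability measure $\pi$ on $\Omega=\{-1,1\}^n$ with $\pi(x)\propto\exp\big(\tfrac12x^{\intercal}Jx\big)$. The Ising model with interaction matrix $\frac\beta nA$, $A$ the adjacency matrix of the complete graph $K_n$, is the Curie-Weiss model at inverse temperature $\beta$. A $d$-regular simple graph on $[n]=\{1,\dots,n\}$ with adjacency matrix $B$ is called an $\epsilon$-expander, where $\epsilon\in(0,1)$, if, writing the eigenvalues of $B$ with multiplicity as $d$ (eigenvector $\mathbf 1=(1,\dots,1)^{\intercal}$) and $\lambda_2,\dots,\lambda_n$ (with eigenvectors orthogonal to $\mathbf 1$), one has $|\lambda_i|\le\epsilon d$ for all $i=2,\dots,n$. For $R\subset[n]$ with $|R|=k$, $\rho^{(k)}[R]=\mathbb{E}_\mu\big(\prod_{i\in R}x^i\big)$ and $\tilde\rho^{(k)}[R]=\mathbb{E}_\nu\big(\prod_{i\in R}x^i\big)$, where $x^i$ denotes the $i$th coordinate of $x$. *)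

theory Defs
  imports "HOL-Probability.Probability_Mass_Function" "Jordan_Normal_Form.Char_Poly"
begin

text \<open>
  The number of vertices is quantified inside the statements, so vectors and matrices are the
  dimension-carrying ones of \<^theory>\<open>Jordan_Normal_Form.Matrix\<close>, indexed from 0: the vertex set
  is \<^term>\<open>{..<n}\<close>. The notation of \<^theory>\<open>HOL-Analysis.Finite_Cartesian_Product\<close> and
  \<^theory>\<open>HOL-Analysis.Inner_Product\<close> is switched off.
\<close>

unbundle no vec_syntax
unbundle no inner_syntax

hide_const (open) Finite_Cartesian_Product.mat Finite_Cartesian_Product.vec
hide_type (open) Finite_Cartesian_Product.vec


section \<open>Ising models\<close>

definition interaction_matrix :: "real mat \<Rightarrow> bool" where
  "interaction_matrix J \<longleftrightarrow>
     square_mat J \<and> transpose_mat J = J \<and> (\<forall>i<dim_row J. J $$ (i, i) = 0)"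

definition spins :: "nat \<Rightarrow> real vec set" where
  "spins n = {x \<in> carrier_vec n. \<forall>i<n. x $ i \<in> {-1, 1}}"

definition ising_weight :: "real mat \<Rightarrow> real vec \<Rightarrow> real" where
  "ising_weight J x = exp (1 / 2 * (x \<bullet> (J *\<^sub>v x)))"

definition ising :: "real mat \<Rightarrow> real vec pmf" where
  "ising J = embed_pmf (\<lambda>x. if x \<in> spins (dim_row J)
     then ising_weight J x / (\<Sum>y\<in>spins (dim_row J). ising_weight J y) else 0)"

definition moment :: "real vec pmf \<Rightarrow> nat set \<Rightarrow> real" where
  "moment p R = measure_pmf.expectation p (\<lambda>x. \<Prod>i\<in>R. x $ i)"

lemma finite_spins: "finite (spins n)"
proof -
  have "spins n \<subseteq> (\<lambda>f. Matrix.vec n f) ` (Pi\<^sub>E {..<n} (\<lambda>_. {-1, 1}))"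
  proof
    fix x assume x: "x \<in> spins n"
    have "x = Matrix.vec n (restrict (\<lambda>i. x $ i) {..<n})"
      using x by (intro eq_vecI) (auto simp: spins_def)
    moreover have "restrict (\<lambda>i. x $ i) {..<n} \<in> Pi\<^sub>E {..<n} (\<lambda>_. {-1, 1})"
      using x by (auto simp: spins_def)
    ultimately show "x \<in> (\<lambda>f. Matrix.vec n f) ` (Pi\<^sub>E {..<n} (\<lambda>_. {-1, 1}))"
      by (rule image_eqI)
  qed
  moreover have "finite (Pi\<^sub>E {..<n} (\<lambda>_::nat. {-1, 1::real}))"
    by (intro finite_PiE) auto
  ultimately show ?thesis
    using finite_subset by blast
qed

lemma spins_nonempty: "spins n \<noteq> {}"
proof -
  have "Matrix.vec n (\<lambda>_. 1) \<in> spins n"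
    by (auto simp: spins_def)
  then show ?thesis by blast
qed

lemma ising_partition_pos: "(\<Sum>y\<in>spins n. ising_weight J y) > 0"
  by (intro sum_pos finite_spins spins_nonempty) (simp add: ising_weight_def)

lemma pmf_ising:
  "pmf (ising J) x = (if x \<in> spins (dim_row J)
     then ising_weight J x / (\<Sum>y\<in>spins (dim_row J). ising_weight J y) else 0)"
proof -
  let ?S = "spins (dim_row J)"
  let ?Z = "\<Sum>y\<in>?S. ising_weight J y"
  let ?f = "\<lambda>x. if x \<in> ?S then ising_weight J x / ?Z else 0"
  have nonneg: "0 \<le> ?f x" for x
    using ising_partition_pos[where J = J and n = "dim_row J"]
    by (auto simp: ising_weight_def)
  have "(\<integral>\<^sup>+x. ennreal (?f x) \<partial>count_space UNIV) = (\<Sum>x\<in>?S. ennreal (?f x))"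
    by (intro nn_integral_count_space'[OF finite_spins]) auto
  also have "\<dots> = ennreal (\<Sum>x\<in>?S. ?f x)"
    by (rule sum_ennreal) (rule nonneg)
  also have "(\<Sum>x\<in>?S. ?f x) = 1"
    using ising_partition_pos[where J = J and n = "dim_row J"]
    by (simp add: sum_divide_distrib[symmetric])
  finally have "(\<integral>\<^sup>+x. ennreal (?f x) \<partial>count_space UNIV) = 1"
    by simp
  from pmf_embed_pmf[OF nonneg this] show ?thesis
    unfolding ising_def by simp
qed


section \<open>Graphs\<close>

definition complete_graph :: "nat \<Rightarrow> nat set set" where
  "complete_graph n = {e. e \<subseteq> {..<n} \<and> card e = 2}"

definition simple_graph :: "nat \<Rightarrow> nat set set \<Rightarrow> bool" where
  "simple_graph n G \<longleftrightarrow> G \<subseteq> complete_graph n"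

definition regular_graph :: "nat \<Rightarrow> nat \<Rightarrow> nat set set \<Rightarrow> bool" where
  "regular_graph n d G \<longleftrightarrow> simple_graph n G \<and> (\<forall>v<n. card {e \<in> G. v \<in> e} = d)"

definition adjacency_mat :: "nat \<Rightarrow> nat set set \<Rightarrow> real mat" where
  "adjacency_mat n G = Matrix.mat n n (\<lambda>(i, j). of_bool ({i, j} \<in> G))"

text \<open>
  The eigenvalues other than the trivial one \<open>d\<close> (eigenvector \<open>\<one>\<close>), with multiplicity, are
  those having an eigenvector orthogonal to \<open>\<one>\<close>; in particular they include \<open>d\<close> itself if the
  graph is disconnected. The edgeless graph, \<open>d = 0\<close>, is not excluded here.
\<close>
definition expander :: "nat \<Rightarrow> nat \<Rightarrow> real \<Rightarrow> nat set set \<Rightarrow> bool" where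
  "expander n d \<epsilon> G \<longleftrightarrow> 0 < \<epsilon> \<and> \<epsilon> < 1 \<and> regular_graph n d G \<and>
     (\<forall>l v. eigenvector (adjacency_mat n G) v l \<and> v \<bullet> Matrix.vec n (\<lambda>_. 1) = 0
        \<longrightarrow> \<bar>l\<bar> \<le> \<epsilon> * real d)"

lemma interaction_matrix_adjacency_mat:
  assumes "simple_graph n G"
  shows "interaction_matrix (c \<cdot>\<^sub>m adjacency_mat n G)"
proof -
  have "{i} \<notin> G" for i
    using assms by (auto simp: simple_graph_def complete_graph_def)
  then show ?thesis
    by (auto simp: interaction_matrix_def adjacency_mat_def insert_commute intro!: eq_matI)
qed

end

theory Submission
  imports Defs
begin

text \<open>
  Let \<open>M\<close> be the magnetization per spin. Beyond the maximum point of \<open>tanh (\<beta> m) - m\<close> the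
  Curie--Weiss response \<open>m \<mapsto> tanh (\<beta> m)\<close> is a contraction, so clamping its argument below at a
  suitable \<open>m\<^sub>0\<close> yields a Glauber kernel \<open>P\<close> that contracts the Hamming--Lipschitz constant on the
  whole cube, even though \<open>\<beta> > 1\<close>. For a test function \<open>f\<close> with coordinate differences at most
  \<open>2 k / n\<close>, the Poisson equation \<open>h - P h = f - c\<close> thus has an approximate solution with
  coordinate differences \<open>O(k)\<close>.

  An Ising measure whose local fields are within \<open>O(\<epsilon> + 1 / n)\<close> of \<open>\<beta> M\<close>, on average over the
  vertices, gives \<open>\<psi>(M) (h - P h)\<close> expectation \<open>O(k (\<epsilon> + 1 / n))\<close> for every Lipschitz cutoff
  \<open>\<psi>\<close> supported on \<open>[m\<^sub>0, \<infinity>)\<close>, where the clamp is inactive. It charges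
  \<open>\<bar>M\<bar> < m\<^sub>1\<close> with exponentially small probability if \<open>\<epsilon>\<close> is small, so for even \<open>f\<close>, by
  spin-flip symmetry, its mean of \<open>f\<close> is \<open>c\<close> up to \<open>O(k (\<epsilon> + 1 / n))\<close>. The constant \<open>c\<close> does not
  depend on the measure. Both \<open>\<mu>\<close> and \<open>\<nu>\<close> qualify, and choosing for \<open>f\<close> the average of
  \<open>\<plusminus> \<Prod>i\<in>R. x i\<close> over \<open>R\<close>, with the signs of the moment differences, gives the claim.
\<close>

section \<open>Hyperbolic tangent and cutoffs\<close>

text \<open>The function \<open>tanh (\<beta> * m) - m\<close> peaks where the slope of the response
  has dropped to 1. It is positive up to the peak and, by continuity, a little beyond, where the
  slope is already below 1. All three thresholds lie in that window: the gap from
  \<open>m\<^sub>0\<close> to \<open>m\<^sub>1\<close> is room for a cutoff, the one from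
  \<open>m\<^sub>1\<close> to \<open>m\<^sub>2\<close> yields an exponential gap between
  tilts.\<close>

lemma tanh_thresholds:
  fixes \<beta> :: real
  assumes "\<beta> > 1"
  obtains m\<^sub>0 m\<^sub>1 m\<^sub>2 where "0 < m\<^sub>0" "m\<^sub>0 < m\<^sub>1" "m\<^sub>1 < m\<^sub>2"
    "\<And>m. \<lbrakk>0 < m; m \<le> m\<^sub>2\<rbrakk> \<Longrightarrow> m < tanh (\<beta> * m)" "\<beta> * (1 - tanh (\<beta> * m\<^sub>0) ^ 2) < 1"
proof -
  define g where "g = (\<lambda>m. tanh (\<beta> * m) - m)"
  define s where "s = sqrt (1 - 1 / \<beta>)"
  have s: "0 < s" "s < 1"
    using assms by (auto simp: s_def real_less_lsqrt)
  obtain y :: real where y: "0 < y" "s < tanh y"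
  proof -
    have "eventually (\<lambda>y. s < tanh y \<and> 0 < y) at_top"
      using order_tendstoD(1)[OF tanh_real_at_top s(2)] eventually_gt_at_top[of "0::real"]
      by (rule eventually_conj)
    then show ?thesis
      using that eventually_happens[of _ "at_top :: real filter"] by auto
  qed
  have "continuous_on {0..y} (\<lambda>x. tanh x)"
    by (intro continuous_intros) auto
  then obtain u where u: "0 \<le> u" "tanh u = s"
    using IVT'[of tanh 0 s y] y s by auto
  \<comment> \<open>The peak of \<open>g\<close>: since \<open>s ^ 2 = 1 - 1 / \<beta>\<close>, the
    derivative of \<open>g\<close> vanishes here.\<close>
  define c where "c = u / \<beta>"
  have tc: "tanh (\<beta> * c) = s"
    using assms u by (simp add: c_def)
  have "u \<noteq> 0"
    using u s by auto
  then have c: "c > 0"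
    using assms u by (simp add: c_def)
  have tc2: "tanh (\<beta> * c) ^ 2 = 1 - 1 / \<beta>"
    using assms by (simp add: tc s_def)
  have deriv: "(g has_real_derivative (\<beta> * (1 - tanh (\<beta> * m) ^ 2) - 1)) (at m)" for m
    unfolding g_def
    by (auto intro!: derivative_eq_intros)
  have cont: "continuous_on S g" for S
    using deriv by (meson DERIV_isCont continuous_at_imp_continuous_on)
  have gpos: "g m > 0" if "0 < m" "m \<le> c" for m
  proof -
    have "g 0 < g m"
    proof (rule DERIV_pos_imp_increasing_open[OF that(1)])
      fix x assume x: "0 < x" "x < m"
      have "tanh (\<beta> * x) < tanh (\<beta> * c)"
        using x that assms by simp
      moreover have "tanh (\<beta> * x) > 0"
        using x assms by simp
      ultimately have "tanh (\<beta> * x) ^ 2 < 1 - 1 / \<beta>"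
        unfolding tc2[symmetric] by (intro power_strict_mono) auto
      then have "\<beta> * (1 - tanh (\<beta> * x) ^ 2) > \<beta> * (1 / \<beta>)"
        using assms by (intro mult_strict_left_mono) auto
      then have "\<beta> * (1 - tanh (\<beta> * x) ^ 2) - 1 > 0"
        using assms by simp
      then show "\<exists>y. DERIV g x :> y \<and> y > 0"
        using deriv by blast
    qed (rule cont)
    then show ?thesis
      by (simp add: g_def)
  qed
  have "isCont g c"
    using deriv DERIV_isCont by blast
  then have "eventually (\<lambda>m. g m > 0) (at c)"
    using gpos[OF c order_refl] by (simp add: isCont_def order_tendstoD)
  then obtain d where d: "d > 0" "\<And>m. m \<noteq> c \<Longrightarrow> dist m c < d \<Longrightarrow> g m > 0"
    unfolding eventually_at by auto
  \<comment> \<open>Three steps of this length stay inside the neighbourhood of \<open>c\<close> on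
    which \<open>g\<close> is positive.\<close>
  define \<delta> where "\<delta> = d / 4"
  have \<delta>: "\<delta> > 0" "3 * \<delta> < d"
    using d by (auto simp: \<delta>_def)
  show ?thesis
  proof
    show "0 < c + \<delta>" "c + \<delta> < c + 2 * \<delta>" "c + 2 * \<delta> < c + 3 * \<delta>"
      using c \<delta> by auto
    show "m < tanh (\<beta> * m)" if "0 < m" "m \<le> c + 3 * \<delta>" for m
    proof (cases "m \<le> c")
      case True
      then show ?thesis using gpos that by (simp add: g_def)
    next
      case False
      then have "g m > 0"
        using that \<delta> by (intro d(2)) (auto simp: dist_real_def)
      then show ?thesis by (simp add: g_def)
    qed
    have "tanh (\<beta> * c) < tanh (\<beta> * (c + \<delta>))"
      using assms \<delta> by simp
    moreover have "tanh (\<beta> * c) > 0"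
      using assms c by simp
    ultimately have "1 - 1 / \<beta> < tanh (\<beta> * (c + \<delta>)) ^ 2"
      unfolding tc2[symmetric] by (intro power_strict_mono) auto
    then have "\<beta> * (1 - tanh (\<beta> * (c + \<delta>)) ^ 2) < \<beta> * (1 / \<beta>)"
      using assms by (intro mult_strict_left_mono) auto
    then show "\<beta> * (1 - tanh (\<beta> * (c + \<delta>)) ^ 2) < 1"
      using assms by simp
  qed
qed

text \<open>The slope of the response decreases on the nonnegative axis, so its value at
  \<open>c\<close> bounds every later slope.\<close>

lemma tanh_lipschitz_beyond:
  fixes \<beta> a b c :: real
  assumes "\<beta> > 0" "0 \<le> c" "c \<le> a" "a \<le> b"
  shows "tanh (\<beta> * b) - tanh (\<beta> * a) \<le> \<beta> * (1 - tanh (\<beta> * c) ^ 2) * (b - a)"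
proof -
  let ?h = "\<lambda>x. \<beta> * (1 - tanh (\<beta> * c) ^ 2) * x - tanh (\<beta> * x)"
  have "?h a \<le> ?h b"
  proof (rule DERIV_nonneg_imp_nondecreasing[OF \<open>a \<le> b\<close>])
    fix x assume x: "a \<le> x" "x \<le> b"
    have "tanh (\<beta> * c) ^ 2 \<le> tanh (\<beta> * x) ^ 2"
      using assms x by (intro power_mono) auto
    then have "\<beta> * tanh (\<beta> * c) ^ 2 \<le> \<beta> * tanh (\<beta> * x) ^ 2"
      using assms by simp
    then have *: "\<beta> * (1 - tanh (\<beta> * c) ^ 2) - \<beta> * (1 - tanh (\<beta> * x) ^ 2) \<ge> 0"
      by (simp add: algebra_simps)
    have "(?h has_real_derivative (\<beta> * (1 - tanh (\<beta> * c) ^ 2) - \<beta> * (1 - tanh (\<beta> * x) ^ 2))) (at x)"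
      by (auto intro!: derivative_eq_intros)
    with * show "\<exists>y. (?h has_real_derivative y) (at x) \<and> 0 \<le> y"
      by blast
  qed
  then show ?thesis
    by (simp add: algebra_simps)
qed

lemma abs_tanh_diff_le: "\<bar>tanh x - tanh y\<bar> \<le> \<bar>x - y\<bar>" for x y :: real
proof -
  have *: "tanh b - tanh a \<le> b - a" if "a \<le> b" for a b :: real
  proof -
    have "(\<lambda>x. x - tanh x) a \<le> (\<lambda>x. x - tanh x) b"
    proof (rule DERIV_nonneg_imp_nondecreasing[OF that])
      fix x :: real
      have "((\<lambda>x. x - tanh x) has_real_derivative (tanh x ^ 2)) (at x)"
        by (auto intro!: derivative_eq_intros)
      then show "\<exists>y. ((\<lambda>x. x - tanh x) has_real_derivative y) (at x) \<and> 0 \<le> y"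
        by (meson zero_le_power2)
    qed
    then show ?thesis by simp
  qed
  show ?thesis
  proof (cases "x \<le> y")
    case True
    then have "tanh x \<le> tanh y" by simp
    then show ?thesis using *[OF True] True by linarith
  next
    case False
    then have "tanh y \<le> tanh x" by simp
    then show ?thesis using *[of y x] False by linarith
  qed
qed

text \<open>Constant below \<open>c\<close>, which removes the steep part of the response around 0,
  where the slope is as large as \<beta>.\<close>

definition clamped_response :: "real \<Rightarrow> real \<Rightarrow> real \<Rightarrow> real" where
  "clamped_response \<beta> c m = tanh (\<beta> * max m c)"

lemma clamped_response_lipschitz:
  assumes "\<beta> > 0" "c \<ge> 0"
  shows "\<bar>clamped_response \<beta> c a - clamped_response \<beta> c b\<bar> \<le> \<beta> * (1 - tanh (\<beta> * c) ^ 2) * \<bar>a - b\<bar>"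
proof -
  let ?k = "\<beta> * (1 - tanh (\<beta> * c) ^ 2)"
  have k: "?k \<ge> 0"
    using assms tanh_real_bounds[of "\<beta> * c"]
    by (intro mult_nonneg_nonneg) (auto simp: abs_square_le_1 abs_le_iff)
  have *: "\<bar>clamped_response \<beta> c a - clamped_response \<beta> c b\<bar> \<le> ?k * \<bar>a - b\<bar>" if "b \<le> a" for a b
  proof -
    have "tanh (\<beta> * max b c) \<le> tanh (\<beta> * max a c)"
      using that assms by auto
    then have "\<bar>clamped_response \<beta> c a - clamped_response \<beta> c b\<bar>
        = tanh (\<beta> * max a c) - tanh (\<beta> * max b c)"
      by (simp add: clamped_response_def)
    also have "\<dots> \<le> ?k * (max a c - max b c)"
      using assms that by (intro tanh_lipschitz_beyond) auto
    also have "\<dots> \<le> ?k * \<bar>a - b\<bar>"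
      using that k by (intro mult_left_mono) auto
    finally show ?thesis .
  qed
  show ?thesis
    using *[of a b] *[of b a] by (cases "b \<le> a") (auto simp: abs_minus_commute)
qed

lemma abs_clamped_response_le_1: "\<bar>clamped_response \<beta> c m\<bar> \<le> 1"
  using tanh_real_bounds[of "\<beta> * max m c"] by (simp add: clamped_response_def abs_le_iff)

definition cutoff :: "real \<Rightarrow> real \<Rightarrow> real \<Rightarrow> real" where
  "cutoff a b m = max 0 (min 1 ((m - a) / (b - a)))"

lemma cutoff_bounds: "0 \<le> cutoff a b m" "cutoff a b m \<le> 1"
  by (auto simp: cutoff_def)

lemma cutoff_eq_0: "a < b \<Longrightarrow> m \<le> a \<Longrightarrow> cutoff a b m = 0"
  by (simp add: cutoff_def divide_le_0_iff max_absorb1 min.coboundedI2)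

lemma cutoff_eq_1: "a < b \<Longrightarrow> b \<le> m \<Longrightarrow> cutoff a b m = 1"
  by (auto simp: cutoff_def max_def min_def field_simps)

lemma cutoff_lipschitz:
  assumes "a < b"
  shows "\<bar>cutoff a b x - cutoff a b y\<bar> \<le> \<bar>x - y\<bar> / (b - a)"
proof -
  have "\<bar>cutoff a b x - cutoff a b y\<bar> \<le> \<bar>(x - a) / (b - a) - (y - a) / (b - a)\<bar>"
    unfolding cutoff_def by linarith
  also have "\<dots> = \<bar>x - y\<bar> / (b - a)"
    using assms by (simp add: diff_divide_distrib[symmetric])
  finally show ?thesis .
qed


section \<open>Contracting Glauber dynamics\<close>

text \<open>Spins are functions rather than vectors so that changing one spin is a function update;
  extensionality makes the set finite and its points determined by their first \<open>n\<close>
  values.\<close>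

definition cube :: "nat \<Rightarrow> (nat \<Rightarrow> real) set" where
  "cube n = {..<n} \<rightarrow>\<^sub>E {-1, 1}"

definition mag :: "nat \<Rightarrow> (nat \<Rightarrow> real) \<Rightarrow> real" where
  "mag n x = (\<Sum>j<n. x j) / real n"

text \<open>The sum omits \<open>i\<close> but is still divided by \<open>n\<close>:
  \<open>\<beta> * cavity_mag n x i\<close> is then exactly the Curie-Weiss field at
  \<open>i\<close>, and resampling spin \<open>i\<close> does not change it.\<close>

definition cavity_mag :: "nat \<Rightarrow> (nat \<Rightarrow> real) \<Rightarrow> nat \<Rightarrow> real" where
  "cavity_mag n x i = (\<Sum>j\<in>{..<n} - {i}. x j) / real n"

definition lipschitz_coord :: "nat \<Rightarrow> real \<Rightarrow> ((nat \<Rightarrow> real) \<Rightarrow> real) \<Rightarrow> bool" where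
  "lipschitz_coord n L h \<longleftrightarrow> (\<forall>x\<in>cube n. \<forall>i<n. \<bar>h (x(i := 1)) - h (x(i := -1))\<bar> \<le> L)"

text \<open>The Markov operator on functions: a uniformly chosen spin is resampled with mean \<tau>
  of its cavity magnetization.\<close>

definition glauber ::
    "nat \<Rightarrow> (real \<Rightarrow> real) \<Rightarrow> ((nat \<Rightarrow> real) \<Rightarrow> real) \<Rightarrow> (nat \<Rightarrow> real) \<Rightarrow> real" where
  "glauber n \<tau> h x = (\<Sum>i<n. (1 + \<tau> (cavity_mag n x i)) / 2 * h (x(i := 1))
                          + (1 - \<tau> (cavity_mag n x i)) / 2 * h (x(i := -1))) / real n"

section \<open>Elementary facts on the cube and on single-spin updates\<close>

lemma finite_cube: "finite (cube n)"
  unfolding cube_def by (intro finite_PiE) auto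

lemma cube_nonempty: "cube n \<noteq> {}"
  by (auto simp: cube_def PiE_eq_empty_iff)

lemma cube_cases: "x \<in> cube n \<Longrightarrow> i < n \<Longrightarrow> x i = 1 \<or> x i = -1"
  by (auto simp: cube_def)

lemma cube_abs [simp]: "x \<in> cube n \<Longrightarrow> i < n \<Longrightarrow> \<bar>x i\<bar> = 1"
  using cube_cases by fastforce

lemma cube_square: "x \<in> cube n \<Longrightarrow> i < n \<Longrightarrow> x i * x i = 1"
  using cube_cases by fastforce

lemma cube_upd [simp]: "x \<in> cube n \<Longrightarrow> i < n \<Longrightarrow> s = 1 \<or> s = -1 \<Longrightarrow> x(i := s) \<in> cube n"
  unfolding cube_def by (auto simp: PiE_iff extensional_def)

lemma cavity_mag_upd [simp]: "cavity_mag n (x(i := s)) i = cavity_mag n x i"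
  by (simp add: cavity_mag_def)

lemma cavity_mag_eq: "i < n \<Longrightarrow> cavity_mag n x i = mag n x - x i / real n"
  by (simp add: cavity_mag_def mag_def sum_diff1 diff_divide_distrib)

lemma cavity_mag_upd_diff:
  assumes "i < n" "j < n" "i \<noteq> j"
  shows "cavity_mag n (x(j := s)) i - cavity_mag n (x(j := t)) i = (s - t) / real n"
proof -
  have *: "(\<Sum>k\<in>{..<n} - {i}. (x(j := u)) k) = u + (\<Sum>k\<in>{..<n} - {i} - {j}. x k)" for u
    using assms by (subst sum.remove[of _ j]) (auto intro!: sum.cong)
  show ?thesis
    unfolding cavity_mag_def * by (simp add: diff_divide_distrib[symmetric])
qed

lemma lipschitz_coordD:
  assumes "lipschitz_coord n L h" "x \<in> cube n" "i < n" "s \<in> {-1, 1}" "t \<in> {-1, 1}" "L \<ge> 0"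
  shows "\<bar>h (x(i := s)) - h (x(i := t))\<bar> \<le> L"
proof -
  have "\<bar>h (x(i := 1)) - h (x(i := -1))\<bar> \<le> L"
    using assms by (auto simp: lipschitz_coord_def)
  then show ?thesis using assms(4-6) by (auto simp: abs_minus_commute)
qed

lemma lipschitz_coord_add:
  assumes "lipschitz_coord n L h" "lipschitz_coord n L' h'"
  shows "lipschitz_coord n (L + L') (\<lambda>x. h x + h' x)"
  unfolding lipschitz_coord_def
proof (intro ballI allI impI)
  fix x i assume "x \<in> cube n" "i < n"
  then have "\<bar>h (x(i := 1)) - h (x(i := -1))\<bar> \<le> L" "\<bar>h' (x(i := 1)) - h' (x(i := -1))\<bar> \<le> L'"
    using assms by (auto simp: lipschitz_coord_def)
  then show "\<bar>h (x(i := 1)) + h' (x(i := 1)) - (h (x(i := -1)) + h' (x(i := -1)))\<bar> \<le> L + L'"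
    by linarith
qed

text \<open>Interpolation from \<open>y\<close> to \<open>x\<close>: the coordinates are exchanged
  one at a time, each at a cost of at most \<open>L\<close>.\<close>

lemma lipschitz_coord_oscillation:
  assumes h: "lipschitz_coord n L h" and L: "L \<ge> 0" and x: "x \<in> cube n" and y: "y \<in> cube n"
  shows "\<bar>h x - h y\<bar> \<le> real n * L"
proof -
  have "\<bar>h (\<lambda>i. if i < k then x i else y i) - h y\<bar> \<le> real k * L" if "k \<le> n" for k
    using that
  proof (induction k)
    case (Suc k)
    let ?z = "\<lambda>i. if i < k then x i else y i"
    have z: "?z \<in> cube n"
      using x y by (auto simp: cube_def PiE_iff extensional_def)
    have eq: "(\<lambda>i. if i < Suc k then x i else y i) = ?z(k := x k)"
      by (auto simp: fun_eq_iff)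
    have eq': "?z(k := y k) = ?z"
      by (auto simp: fun_eq_iff)
    have "\<bar>h (?z(k := x k)) - h (?z(k := y k))\<bar> \<le> L"
      using cube_cases[OF x, of k] cube_cases[OF y, of k] Suc.prems
      by (intro lipschitz_coordD[OF h z _ _ _ L]) auto
    then have "\<bar>h (\<lambda>i. if i < Suc k then x i else y i) - h ?z\<bar> \<le> L"
      unfolding eq eq' .
    then show ?case
      using Suc.IH Suc.prems by (simp add: algebra_simps)
  qed auto
  from this[of n] have "\<bar>h (\<lambda>i. if i < n then x i else y i) - h y\<bar> \<le> real n * L"
    by simp
  moreover have "(\<lambda>i. if i < n then x i else y i) = x"
    using x y by (auto simp: fun_eq_iff cube_def PiE_iff extensional_def)
  ultimately show ?thesis by simp
qed

section \<open>Contraction and the Poisson equation for the Glauber operator\<close>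

lemma glauber_sum:
  "glauber n \<tau> (\<lambda>x. \<Sum>t\<in>T. h t x) x = (\<Sum>t\<in>T. glauber n \<tau> (h t) x)"
proof -
  have "glauber n \<tau> (\<lambda>x. \<Sum>t\<in>T. h t x) x =
     (\<Sum>i<n. \<Sum>t\<in>T. (1 + \<tau> (cavity_mag n x i)) / 2 * h t (x(i := 1))
                          + (1 - \<tau> (cavity_mag n x i)) / 2 * h t (x(i := -1))) / real n"
    unfolding glauber_def by (simp add: sum_distrib_left sum.distrib)
  also have "\<dots> = (\<Sum>t\<in>T. glauber n \<tau> (h t) x)"
    unfolding glauber_def by (subst sum.swap) (simp add: sum_divide_distrib)
  finally show ?thesis .
qed

lemma glauber_bounded:
  assumes \<tau>: "\<And>m. \<bar>\<tau> m\<bar> \<le> 1" and h: "\<And>x. x \<in> cube n \<Longrightarrow> \<bar>h x\<bar> \<le> b"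
    and x: "x \<in> cube n" and n: "n > 0"
  shows "\<bar>glauber n \<tau> h x\<bar> \<le> b"
proof -
  have "\<bar>\<Sum>i<n. (1 + \<tau> (cavity_mag n x i)) / 2 * h (x(i := 1))
        + (1 - \<tau> (cavity_mag n x i)) / 2 * h (x(i := -1))\<bar> \<le> (\<Sum>i<n. b)"
  proof (rule order_trans[OF sum_abs sum_mono])
    fix i assume i: "i \<in> {..<n}"
    let ?p = "(1 + \<tau> (cavity_mag n x i)) / 2" and ?q = "(1 - \<tau> (cavity_mag n x i)) / 2"
    have pq: "?p \<ge> 0" "?q \<ge> 0" "?p + ?q = 1"
      using \<tau>[of "cavity_mag n x i"] by (auto simp: field_simps)
    have "\<bar>?p * h (x(i := 1)) + ?q * h (x(i := -1))\<bar> \<le> \<bar>?p * h (x(i := 1))\<bar> + \<bar>?q * h (x(i := -1))\<bar>"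
      by (rule abs_triangle_ineq)
    also have "\<dots> = ?p * \<bar>h (x(i := 1))\<bar> + ?q * \<bar>h (x(i := -1))\<bar>"
      using pq by (simp add: abs_mult)
    also have "\<dots> \<le> ?p * b + ?q * b"
      using pq x i by (intro add_mono mult_left_mono h) auto
    also have "\<dots> = b"
      using pq by (metis distrib_right mult_1)
    finally show "\<bar>?p * h (x(i := 1)) + ?q * h (x(i := -1))\<bar> \<le> b" .
  qed
  then show ?thesis
    using n by (simp add: glauber_def divide_le_eq mult.commute)
qed

text \<open>Path coupling of two configurations that differ only at \<open>j\<close>. Resampling
  \<open>j\<close>, with probability \<open>1 / n\<close>, removes the disagreement; resampling
  another spin keeps it and creates a second one with probability at most
  \<open>\<kappa> / n\<close>. The resulting factor \<open>(1 - 1 / n) * (1 + \<kappa> / n)\<close>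
  is at most \<open>1 - (1 - \<kappa>) / n\<close>.\<close>

lemma glauber_lipschitz:
  assumes \<tau>: "\<And>m. \<bar>\<tau> m\<bar> \<le> 1" and \<kappa>: "\<And>a b. \<bar>\<tau> a - \<tau> b\<bar> \<le> \<kappa> * \<bar>a - b\<bar>"
    and h: "lipschitz_coord n L h" and L: "L \<ge> 0" and n: "n > 0"
  shows "lipschitz_coord n ((1 - (1 - \<kappa>) / real n) * L) (glauber n \<tau> h)"
  unfolding lipschitz_coord_def
proof (intro ballI allI impI)
  fix z j assume z: "z \<in> cube n" and j: "j < n"
  define x where "x = z(j := 1)"
  define y where "y = z(j := -1)"
  have xy: "x \<in> cube n" "y \<in> cube n"
    using z j by (auto simp: x_def y_def)
  have \<kappa>0: "\<kappa> \<ge> 0"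
    using \<kappa>[of 0 1] by simp
  define u where "u = (\<lambda>x i. (1 + \<tau> (cavity_mag n x i)) / 2 * h (x(i := 1))
        + (1 - \<tau> (cavity_mag n x i)) / 2 * h (x(i := -1)))"
  have uj: "u x j - u y j = 0"
    by (simp add: u_def x_def y_def)
  have ui: "\<bar>u x i - u y i\<bar> \<le> (1 + \<kappa> / real n) * L" if i: "i < n" "i \<noteq> j" for i
  proof -
    define p where "p = (1 + \<tau> (cavity_mag n x i)) / 2"
    define p' where "p' = (1 + \<tau> (cavity_mag n y i)) / 2"
    have p: "0 \<le> p" "0 \<le> 1 - p"
      using \<tau>[of "cavity_mag n x i"] by (auto simp: p_def field_simps)
    have "\<bar>p - p'\<bar> = \<bar>\<tau> (cavity_mag n x i) - \<tau> (cavity_mag n y i)\<bar> / 2"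
      by (simp add: p_def p'_def diff_divide_distrib[symmetric])
    also have "\<dots> \<le> \<kappa> * \<bar>cavity_mag n x i - cavity_mag n y i\<bar> / 2"
      using \<kappa> by simp
    also have "\<dots> = \<kappa> / real n"
      unfolding x_def y_def using i j by (simp add: cavity_mag_upd_diff)
    finally have pp: "\<bar>p - p'\<bar> \<le> \<kappa> / real n" .
    have d: "\<bar>h (x(i := s)) - h (y(i := s))\<bar> \<le> L" if "s \<in> {-1, 1}" for s
    proof -
      have "x(i := s) = (z(i := s))(j := 1)" "y(i := s) = (z(i := s))(j := -1)"
        unfolding x_def y_def using i by (rule_tac fun_upd_twist; simp)+
      then show ?thesis
        using h z i j that by (auto simp: lipschitz_coord_def)
    qed
    have dy: "\<bar>h (y(i := 1)) - h (y(i := -1))\<bar> \<le> L"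
      using h xy i by (auto simp: lipschitz_coord_def)
    \<comment> \<open>The coupling in formulas: the first two terms resample \<open>i\<close> to the
      same value on both sides, the last one accounts for the mismatch of the two
      probabilities.\<close>
    have "u x i - u y i = p * (h (x(i := 1)) - h (y(i := 1)))
        + (1 - p) * (h (x(i := -1)) - h (y(i := -1)))
        + (p - p') * (h (y(i := 1)) - h (y(i := -1)))"
      unfolding u_def p_def p'_def by (simp add: field_simps)
    also have "\<bar>\<dots>\<bar> \<le> p * L + (1 - p) * L + \<kappa> / real n * L"
    proof -
      have "\<bar>p * (h (x(i := 1)) - h (y(i := 1)))\<bar> \<le> p * L"
        using p d[of 1] by (simp add: abs_mult mult_left_mono)
      moreover have "\<bar>(1 - p) * (h (x(i := -1)) - h (y(i := -1)))\<bar> \<le> (1 - p) * L"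
        using p d[of "-1"] by (simp add: abs_mult mult_left_mono)
      moreover have "\<bar>(p - p') * (h (y(i := 1)) - h (y(i := -1)))\<bar> \<le> \<kappa> / real n * L"
        using pp dy L \<kappa>0 unfolding abs_mult by (intro mult_mono) auto
      ultimately show ?thesis by linarith
    qed
    also have "\<dots> = (1 + \<kappa> / real n) * L"
      by (simp add: ring_distribs)
    finally show ?thesis .
  qed
  have "\<bar>\<Sum>i<n. u x i - u y i\<bar> \<le> (\<Sum>i<n. \<bar>u x i - u y i\<bar>)"
    by (rule sum_abs)
  also have "\<dots> = (\<Sum>i\<in>{..<n} - {j}. \<bar>u x i - u y i\<bar>)"
    using j uj by (subst sum.remove[of _ j]) auto
  also have "\<dots> \<le> (\<Sum>i\<in>{..<n} - {j}. (1 + \<kappa> / real n) * L)"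
    by (intro sum_mono ui) auto
  also have "\<dots> = (real n - 1) * ((1 + \<kappa> / real n) * L)"
    using j by (simp add: of_nat_diff)
  finally have "\<bar>\<Sum>i<n. u x i - u y i\<bar> / real n \<le> (real n - 1) * ((1 + \<kappa> / real n) * L) / real n"
    by (intro divide_right_mono) auto
  also have "\<dots> \<le> (1 - (1 - \<kappa>) / real n) * L"
  proof -
    have "(real n - 1) * (1 + \<kappa> / real n) / real n = 1 - (1 - \<kappa>) / real n - \<kappa> / (real n * real n)"
      using n by (simp add: field_simps)
    also have "\<dots> \<le> 1 - (1 - \<kappa>) / real n"
      using \<kappa>0 by simp
    finally have "(real n - 1) * (1 + \<kappa> / real n) / real n * L \<le> (1 - (1 - \<kappa>) / real n) * L"
      using L by (intro mult_right_mono)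
    then show ?thesis by (simp add: mult_ac)
  qed
  finally show "\<bar>glauber n \<tau> h (z(j := 1)) - glauber n \<tau> h (z(j := -1))\<bar> \<le> (1 - (1 - \<kappa>) / real n) * L"
    unfolding glauber_def u_def x_def y_def
    by (simp only: diff_divide_distrib[symmetric] sum_subtractf[symmetric] abs_divide abs_of_nat)
qed

text \<open>As \<open>x i\<close> is a sign, \<open>h x\<close> is one of the two values being
  averaged, so its deviation from their mean is a multiple of the discrete derivative at
  \<open>i\<close>. That derivative does not depend on \<open>x i\<close>, which is what the Stein
  identity requires.\<close>

lemma diff_glauber:
  assumes x: "x \<in> cube n" and n: "n > 0"
  shows "h x - glauber n \<tau> h x =
    (\<Sum>i<n. (x i - \<tau> (cavity_mag n x i)) * (h (x(i := 1)) - h (x(i := -1)))) / (2 * real n)"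
proof -
  have *: "h x - ((1 + t) / 2 * h (x(i := 1)) + (1 - t) / 2 * h (x(i := -1)))
      = (x i - t) * (h (x(i := 1)) - h (x(i := -1))) / 2" if "i < n" for i t
    using cube_cases[OF x that]
  proof
    assume i: "x i = 1"
    then have "x(i := 1) = x"
      by (simp add: fun_eq_iff)
    then show ?thesis
      using i by (simp add: field_simps)
  next
    assume i: "x i = -1"
    then have "x(i := -1) = x"
      by (simp add: fun_eq_iff)
    then show ?thesis
      using i by (simp add: field_simps)
  qed
  have "h x - glauber n \<tau> h x = (\<Sum>i<n. h x - ((1 + \<tau> (cavity_mag n x i)) / 2 * h (x(i := 1))
                          + (1 - \<tau> (cavity_mag n x i)) / 2 * h (x(i := -1)))) / real n"
    using n by (simp add: glauber_def sum_subtractf diff_divide_distrib)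
  also have "\<dots> = (\<Sum>i<n. (x i - \<tau> (cavity_mag n x i)) * (h (x(i := 1)) - h (x(i := -1))) / 2) / real n"
    by (intro arg_cong2[of _ _ _ _ "(/)"] sum.cong refl *) auto
  also have "\<dots> = (\<Sum>i<n. (x i - \<tau> (cavity_mag n x i)) * (h (x(i := 1)) - h (x(i := -1)))) / (2 * real n)"
    by (simp add: sum_divide_distrib[symmetric])
  finally show ?thesis .
qed

text \<open>
  The Poisson equation \<open>h - P h = f - const\<close> of the contracting kernel, solved up to an
  error \<open>\<delta>\<close> by truncating the Neumann series; neither the stationary measure nor a limit is needed.
\<close>
lemma approx_poisson_solution:
  assumes \<tau>: "\<And>m. \<bar>\<tau> m\<bar> \<le> 1" and \<kappa>: "\<And>a b. \<bar>\<tau> a - \<tau> b\<bar> \<le> \<kappa> * \<bar>a - b\<bar>" and "\<kappa> < 1"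
    and f: "lipschitz_coord n L f" and L: "L \<ge> 0" and n: "n > 0" and "\<delta> > 0"
    and b: "\<And>x. x \<in> cube n \<Longrightarrow> \<bar>f x\<bar> \<le> b"
  obtains h c where "lipschitz_coord n (real n * L / (1 - \<kappa>)) h" "\<bar>c\<bar> \<le> b"
    "\<And>x. x \<in> cube n \<Longrightarrow> \<bar>(h x - glauber n \<tau> h x) - (f x - c)\<bar> \<le> \<delta>"
proof -
  \<comment> \<open>The contraction factor of one step; the geometric series of its powers is at
    most \<open>n / (1 - \<kappa>)\<close>.\<close>
  define r where "r = 1 - (1 - \<kappa>) / real n"
  have \<kappa>0: "\<kappa> \<ge> 0"
    using \<kappa>[of 0 1] by simp
  have "(1 - \<kappa>) / real n \<le> 1"
    using n \<kappa>0 by (simp add: divide_le_eq)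
  then have r: "0 \<le> r" "r < 1"
    using n \<open>\<kappa> < 1\<close> by (auto simp: r_def)
  define F where "F = (\<lambda>t. (glauber n \<tau> ^^ t) f)"
  have F_Suc: "F (Suc t) = glauber n \<tau> (F t)" for t
    by (simp add: F_def)
  have lip: "lipschitz_coord n (r ^ t * L) (F t)" for t
  proof (induction t)
    case (Suc t)
    then show ?case
      using glauber_lipschitz[OF \<tau> \<kappa> Suc _ n] r L by (simp add: F_Suc r_def mult.assoc)
  qed (use f in \<open>simp add: F_def\<close>)
  have bdd: "x \<in> cube n \<Longrightarrow> \<bar>F t x\<bar> \<le> b" for t x
  proof (induction t arbitrary: x)
    case (Suc t)
    then show ?case
      unfolding F_Suc by (intro glauber_bounded[OF \<tau> _ _ n])
  qed (use b in \<open>simp add: F_def\<close>)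
  define h where "h = (\<lambda>T x. \<Sum>t<T. F t x)"
  have hlip: "lipschitz_coord n (\<Sum>t<T. r ^ t * L) (h T)" for T
  proof (induction T)
    case 0
    then show ?case by (simp add: h_def lipschitz_coord_def)
  next
    case (Suc T)
    then show ?case
      using lipschitz_coord_add[OF Suc lip[of T]] by (simp add: h_def)
  qed
  have geo: "(\<Sum>t<T. r ^ t * L) \<le> real n * L / (1 - \<kappa>)" for T
  proof -
    have "(\<Sum>t<T. r ^ t) = (1 - r ^ T) / (1 - r)"
      using r by (simp add: sum_gp_strict)
    also have "\<dots> \<le> 1 / (1 - r)"
      using r by (intro divide_right_mono) auto
    also have "\<dots> = real n / (1 - \<kappa>)"
      by (simp add: r_def)
    finally have "(\<Sum>t<T. r ^ t) * L \<le> real n / (1 - \<kappa>) * L"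
      using L by (intro mult_right_mono)
    then show ?thesis by (simp add: sum_distrib_right)
  qed
  have tele: "h T x - glauber n \<tau> (h T) x = f x - F T x" for T x
  proof -
    have "glauber n \<tau> (h T) x = (\<Sum>t<T. F (Suc t) x)"
      unfolding h_def glauber_sum F_Suc ..
    then show ?thesis
      using sum_lessThan_telescope'[of "\<lambda>t. F t x" T]
      by (simp add: h_def sum_subtractf F_def)
  qed
  \<comment> \<open>After \<open>T\<close> steps the iterate is constant on the cube up to \<delta>,
    so its value at any one point can serve as \<open>c\<close>. The added 1 keeps the denominator
    positive when \<open>L = 0\<close>.\<close>
  obtain T where T: "r ^ T < \<delta> / (real n * L + 1)"
  proof -
    have "\<delta> / (real n * L + 1) > 0"
      using \<open>\<delta> > 0\<close> L by (simp add: add_nonneg_pos)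
    then show ?thesis
      using real_arch_pow_inv[OF _ r(2)] that by blast
  qed
  obtain x\<^sub>0 where x0: "x\<^sub>0 \<in> cube n"
    using cube_nonempty by blast
  show ?thesis
  proof
    show "lipschitz_coord n (real n * L / (1 - \<kappa>)) (h T)"
      using hlip[of T] geo[of T] by (force simp: lipschitz_coord_def intro: order_trans)
    show "\<bar>F T x\<^sub>0\<bar> \<le> b"
      using bdd x0 by blast
    fix x assume x: "x \<in> cube n"
    have "\<bar>(h T x - glauber n \<tau> (h T) x) - (f x - F T x\<^sub>0)\<bar> = \<bar>F T x - F T x\<^sub>0\<bar>"
      by (simp add: tele abs_minus_commute)
    also have "\<dots> \<le> real n * (r ^ T * L)"
      using lipschitz_coord_oscillation[OF lip _ x x0] L r by simp
    also have "\<dots> = r ^ T * (real n * L)"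
      by simp
    also have "\<dots> \<le> r ^ T * (real n * L + 1)"
      using r by (intro mult_left_mono) auto
    also have "\<dots> \<le> \<delta>"
      using T L by (simp add: less_divide_eq add_nonneg_pos less_imp_le)
    finally show "\<bar>(h T x - glauber n \<tau> (h T) x) - (f x - F T x\<^sub>0)\<bar> \<le> \<delta>" .
  qed
qed


section \<open>Gibbs measures close to the Curie--Weiss model\<close>

definition local_field :: "nat \<Rightarrow> (nat \<Rightarrow> nat \<Rightarrow> real) \<Rightarrow> (nat \<Rightarrow> real) \<Rightarrow> nat \<Rightarrow> real" where
  "local_field n J x i = (\<Sum>j<n. J i j * x j)"

definition energy :: "nat \<Rightarrow> (nat \<Rightarrow> nat \<Rightarrow> real) \<Rightarrow> (nat \<Rightarrow> real) \<Rightarrow> real" where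
  "energy n J x = 1 / 2 * (\<Sum>i<n. x i * local_field n J x i)"

definition gibbs_prob :: "nat \<Rightarrow> (nat \<Rightarrow> nat \<Rightarrow> real) \<Rightarrow> (nat \<Rightarrow> real) \<Rightarrow> real" where
  "gibbs_prob n J x = exp (energy n J x) / (\<Sum>y\<in>cube n. exp (energy n J y))"

definition gibbs_avg :: "nat \<Rightarrow> (nat \<Rightarrow> nat \<Rightarrow> real) \<Rightarrow> ((nat \<Rightarrow> real) \<Rightarrow> real) \<Rightarrow> real" where
  "gibbs_avg n J F = (\<Sum>x\<in>cube n. gibbs_prob n J x * F x)"

definition flip_all :: "nat \<Rightarrow> (nat \<Rightarrow> real) \<Rightarrow> nat \<Rightarrow> real" where
  "flip_all n x = restrict (\<lambda>i. - x i) {..<n}"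

text \<open>\<open>tilt \<beta> m ^ n\<close> is the sum of \<open>exp (\<beta> n (m M - m\<^sup>2 / 2))\<close> over the cube.\<close>
definition tilt :: "real \<Rightarrow> real \<Rightarrow> real" where
  "tilt \<beta> m = 2 * cosh (\<beta> * m) * exp (- (\<beta> * m ^ 2 / 2))"

section \<open>Gibbs averages and spin-flip symmetry\<close>

lemma partition_pos: "(\<Sum>y\<in>cube n. exp (energy n J y)) > 0"
  by (intro sum_pos finite_cube cube_nonempty) auto

lemma gibbs_prob_nonneg: "gibbs_prob n J x \<ge> 0"
  using partition_pos[of n J] by (simp add: gibbs_prob_def)

lemma sum_gibbs_prob: "(\<Sum>x\<in>cube n. gibbs_prob n J x) = 1"
  using partition_pos[of n J] by (simp add: gibbs_prob_def sum_divide_distrib[symmetric])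

lemma gibbs_avg_cong: "(\<And>x. x \<in> cube n \<Longrightarrow> F x = G x) \<Longrightarrow> gibbs_avg n J F = gibbs_avg n J G"
  by (simp add: gibbs_avg_def)

lemma gibbs_avg_add: "gibbs_avg n J (\<lambda>x. F x + G x) = gibbs_avg n J F + gibbs_avg n J G"
  by (simp add: gibbs_avg_def distrib_left sum.distrib)

lemma gibbs_avg_diff: "gibbs_avg n J (\<lambda>x. F x - G x) = gibbs_avg n J F - gibbs_avg n J G"
  by (simp add: gibbs_avg_def right_diff_distrib sum_subtractf)

lemma gibbs_avg_cmult: "gibbs_avg n J (\<lambda>x. c * F x) = c * gibbs_avg n J F"
  by (simp add: gibbs_avg_def sum_distrib_left mult.left_commute)

lemma gibbs_avg_divide: "gibbs_avg n J (\<lambda>x. F x / c) = gibbs_avg n J F / c"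
  by (simp add: gibbs_avg_def sum_divide_distrib)

lemma gibbs_avg_const: "gibbs_avg n J (\<lambda>x. c) = c"
  by (simp add: gibbs_avg_def sum_distrib_right[symmetric] sum_gibbs_prob)

lemma gibbs_avg_sum: "gibbs_avg n J (\<lambda>x. \<Sum>i\<in>I. F i x) = (\<Sum>i\<in>I. gibbs_avg n J (F i))"
  unfolding gibbs_avg_def sum_distrib_left by (rule sum.swap)

lemma abs_gibbs_avg_le:
  assumes "\<And>x. x \<in> cube n \<Longrightarrow> \<bar>F x\<bar> \<le> G x"
  shows "\<bar>gibbs_avg n J F\<bar> \<le> gibbs_avg n J G"
proof -
  have "\<bar>gibbs_avg n J F\<bar> \<le> (\<Sum>x\<in>cube n. gibbs_prob n J x * \<bar>F x\<bar>)"
    unfolding gibbs_avg_def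
    by (rule order_trans[OF sum_abs]) (simp add: abs_mult gibbs_prob_nonneg)
  also have "\<dots> \<le> gibbs_avg n J G"
    unfolding gibbs_avg_def by (intro sum_mono mult_left_mono gibbs_prob_nonneg assms)
  finally show ?thesis .
qed

lemma flip_all_cube: "x \<in> cube n \<Longrightarrow> flip_all n x \<in> cube n"
  by (auto simp: cube_def flip_all_def PiE_iff extensional_def)

lemma flip_all_flip_all: "x \<in> cube n \<Longrightarrow> flip_all n (flip_all n x) = x"
  by (auto simp: cube_def flip_all_def PiE_iff extensional_def fun_eq_iff)

lemma mag_flip_all: "mag n (flip_all n x) = - mag n x"
  by (simp add: mag_def flip_all_def sum_negf)

lemma energy_flip_all: "energy n J (flip_all n x) = energy n J x"
  by (simp add: energy_def local_field_def flip_all_def sum_negf)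

lemma gibbs_avg_flip_all: "gibbs_avg n J (\<lambda>x. F (flip_all n x)) = gibbs_avg n J F"
  unfolding gibbs_avg_def
  by (rule sum.reindex_bij_witness[of _ "flip_all n" "flip_all n"])
     (simp_all add: flip_all_cube flip_all_flip_all gibbs_prob_def energy_flip_all)

lemma sum_cube_exp: "(\<Sum>x\<in>cube n. exp (t * (\<Sum>i<n. x i))) = (2 * cosh t) ^ n"
proof -
  have "(\<Sum>x\<in>cube n. exp (t * (\<Sum>i<n. x i))) = (\<Sum>x\<in>cube n. \<Prod>i<n. exp (t * x i))"
    by (simp add: sum_distrib_left exp_sum)
  also have "\<dots> = (\<Prod>i<n. \<Sum>y\<in>{-1, 1}. exp (t * y))"
    unfolding cube_def by (subst prod_sum_PiE) auto
  also have "(\<Sum>y\<in>{-1, 1}. exp (t * y)) = 2 * cosh t"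
    by (simp add: cosh_def)
  finally show ?thesis by simp
qed

text \<open>Leaves at most \<open>2 * n + 1\<close> values for the magnetization, few enough for a
  union bound.\<close>

lemma sum_cube_int:
  assumes "x \<in> cube n"
  obtains s :: int where "(\<Sum>i<n. x i) = of_int s" "s \<in> {- int n..int n}"
proof -
  have "(\<Sum>i<n. x i) = (\<Sum>i<n. of_int (\<lfloor>x i\<rfloor>))"
    using cube_cases[OF assms] by (intro sum.cong) fastforce+
  then have eq: "(\<Sum>i<n. x i) = of_int (\<Sum>i<n. \<lfloor>x i\<rfloor>)"
    by simp
  have "\<bar>\<Sum>i<n. x i\<bar> \<le> (\<Sum>i<n. \<bar>x i\<bar>)"
    by (rule sum_abs)
  also have "\<dots> = real n"
    using assms by simp
  finally have "\<bar>of_int (\<Sum>i<n. \<lfloor>x i\<rfloor>)\<bar> \<le> real n"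
    unfolding eq .
  then have "(\<Sum>i<n. \<lfloor>x i\<rfloor>) \<in> {- int n..int n}"
    unfolding atLeastAtMost_iff by linarith
  with eq show ?thesis
    by (rule that)
qed

lemma tilt_pos: "tilt \<beta> m > 0"
  by (simp add: tilt_def)

lemma tilt_minus [simp]: "tilt \<beta> (- m) = tilt \<beta> m"
  by (simp add: tilt_def)

text \<open>The logarithmic derivative of \<open>tilt \<beta>\<close> is
  \<open>\<beta> * (tanh (\<beta> * m) - m)\<close>, which \<open>inc\<close> makes
  positive.\<close>

lemma tilt_mono:
  assumes \<beta>: "\<beta> > 0" and inc: "\<And>m. \<lbrakk>0 < m; m \<le> M\<rbrakk> \<Longrightarrow> m < tanh (\<beta> * m)"
    and ab: "0 \<le> a" "a < b" "b \<le> M"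
  shows "tilt \<beta> a < tilt \<beta> b"
proof (rule DERIV_pos_imp_increasing_open[OF ab(2)])
  have deriv: "(tilt \<beta> has_real_derivative
      2 * \<beta> * exp (- (\<beta> * m ^ 2 / 2)) * (sinh (\<beta> * m) - m * cosh (\<beta> * m))) (at m)" for m
    unfolding tilt_def
    by (auto intro!: derivative_eq_intros simp: algebra_simps)
  show "\<exists>y. DERIV (tilt \<beta>) m :> y \<and> y > 0" if "a < m" "m < b" for m
  proof -
    have "m * cosh (\<beta> * m) < tanh (\<beta> * m) * cosh (\<beta> * m)"
      using inc[of m] that ab by (intro mult_strict_right_mono) auto
    also have "\<dots> = sinh (\<beta> * m)"
      by (simp add: tanh_def)
    finally have "2 * \<beta> * exp (- (\<beta> * m ^ 2 / 2)) * (sinh (\<beta> * m) - m * cosh (\<beta> * m)) > 0"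
      using \<beta> by simp
    then show ?thesis using deriv by blast
  qed
  show "continuous_on {a..b} (tilt \<beta>)"
    using deriv by (meson DERIV_isCont continuous_at_imp_continuous_on)
qed

section \<open>Single-site detailed balance and the Stein identity\<close>

lemma exp_mult_one_minus_tanh: "exp (2 * a) * (1 - tanh a) = 1 + tanh (a :: real)"
proof -
  define E where "E = exp (-2 * a)"
  have E: "E > 0" "exp (2 * a) * E = 1"
    by (simp_all add: E_def exp_add[symmetric])
  have "1 - tanh a = 2 * E / (1 + E)" "1 + tanh a = 2 / (1 + E)"
    unfolding tanh_real_altdef E_def[symmetric] using E(1) by (auto simp: field_simps)
  then have "exp (2 * a) * (1 - tanh a) = exp (2 * a) * E * (1 + tanh a)"
    by simp
  then show ?thesis
    using E(2) by simp
qed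

lemma local_field_upd:
  assumes "J i i = 0"
  shows "local_field n J (x(i := s)) i = local_field n J x i"
  unfolding local_field_def using assms by (intro sum.cong) auto

text \<open>By symmetry each interaction with \<open>i\<close> occurs twice in the double sum, which
  cancels the factor 1/2; the remaining sum does not involve \<open>x i\<close>.\<close>

lemma energy_split:
  assumes sym: "\<And>j k. j < n \<Longrightarrow> k < n \<Longrightarrow> J j k = J k j" and diag: "J i i = 0" and i: "i < n"
  shows "energy n J x = x i * local_field n J x i
     + (\<Sum>j\<in>{..<n} - {i}. \<Sum>k\<in>{..<n} - {i}. x j * J j k * x k) / 2"
proof -
  let ?A = "{..<n} - {i}"
  have lf: "local_field n J x j = J j i * x i + (\<Sum>k\<in>?A. J j k * x k)" for j
    unfolding local_field_def using i by (subst sum.remove[of _ i]) auto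
  have "(\<Sum>j<n. x j * local_field n J x j)
      = x i * local_field n J x i + (\<Sum>j\<in>?A. x j * local_field n J x j)"
    using i by (subst sum.remove[of _ i]) auto
  also have "(\<Sum>j\<in>?A. x j * local_field n J x j)
      = x i * (\<Sum>j\<in>?A. J j i * x j) + (\<Sum>j\<in>?A. \<Sum>k\<in>?A. x j * J j k * x k)"
    unfolding lf by (simp add: sum.distrib sum_distrib_left algebra_simps)
  also have "(\<Sum>j\<in>?A. J j i * x j) = local_field n J x i"
    unfolding lf using diag sym i by simp
  finally show ?thesis
    by (simp add: energy_def)
qed

text \<open>The Glauber update of coordinate \<open>i\<close> leaves the Gibbs measure invariant.\<close>
lemma stein_identity:
  assumes sym: "\<And>j k. j < n \<Longrightarrow> k < n \<Longrightarrow> J j k = J k j" and diag: "J i i = 0" and i: "i < n"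
    and g: "\<And>x s. g (x(i := s)) = g x"
  shows "gibbs_avg n J (\<lambda>x. (x i - tanh (local_field n J x i)) * g x) = 0"
proof -
  define R where "R = (\<lambda>x. (\<Sum>j\<in>{..<n} - {i}. \<Sum>k\<in>{..<n} - {i}. x j * J j k * x k) / 2)"
  define F where "F = (\<lambda>x. exp (energy n J x) * ((x i - tanh (local_field n J x i)) * g x))"
  have E: "energy n J x = x i * local_field n J x i + R x" for x
    unfolding R_def using energy_split[of n J i x] sym diag i by auto
  have R_upd: "R (x(i := s)) = R x" for x s
    unfolding R_def by (intro arg_cong2[of _ _ _ _ "(/)"] sum.cong refl) auto
  \<comment> \<open>Configurations are paired with their flip at \<open>i\<close>. Each pair
    cancels: given the other spins, \<open>x i\<close> has weights proportional to
    \<open>exp a\<close> and \<open>exp (- a)\<close> for the local field \<open>a\<close>, hence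
    mean \<open>tanh a\<close>.\<close>
  have "(\<Sum>x\<in>cube n. F x) = (\<Sum>x\<in>cube n. F (x(i := - x i)))"
    by (rule sum.reindex_bij_witness[of _ "\<lambda>x. x(i := - x i)" "\<lambda>x. x(i := - x i)"])
       (use i cube_cases in \<open>fastforce simp: fun_eq_iff\<close>)+
  moreover have "F x + F (x(i := - x i)) = 0" if "x \<in> cube n" for x
  proof -
    let ?a = "local_field n J x i"
    have "F x + F (x(i := - x i)) = exp (R x) * g x *
        (exp (x i * ?a) * (x i - tanh ?a) + exp (- x i * ?a) * (- x i - tanh ?a))"
      unfolding F_def E R_upd local_field_upd[where J = J, OF diag] g
      by (simp add: exp_add exp_diff exp_minus divide_inverse algebra_simps)
    moreover have "exp ?a * (1 - tanh ?a) = exp (- ?a) * (1 + tanh ?a)"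
      unfolding exp_mult_one_minus_tanh[symmetric, of ?a]
      by (simp add: mult.assoc[symmetric] exp_add[symmetric])
    then have "exp (x i * ?a) * (x i - tanh ?a) + exp (- x i * ?a) * (- x i - tanh ?a) = 0"
      using cube_cases[OF that i] by (auto simp: algebra_simps)
    ultimately show ?thesis by simp
  qed
  then have "(\<Sum>x\<in>cube n. F x) + (\<Sum>x\<in>cube n. F (x(i := - x i))) = 0"
    by (simp add: sum.distrib[symmetric])
  ultimately have "(\<Sum>x\<in>cube n. F x) = 0"
    by simp
  then show ?thesis
    by (simp add: gibbs_avg_def gibbs_prob_def F_def sum_divide_distrib[symmetric])
qed

text \<open>The closeness condition shared by both models. Fields are compared on average over the
  vertices only, because a spectral gap controls them in the Euclidean norm and not vertex by
  vertex.\<close>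

locale near_curie_weiss =
  fixes n :: nat and \<beta> \<eta> :: real and J :: "nat \<Rightarrow> nat \<Rightarrow> real"
  assumes n_pos: "n > 0" and \<beta>_pos: "\<beta> > 0"
    and sym: "\<And>i j. i < n \<Longrightarrow> j < n \<Longrightarrow> J i j = J j i"
    and diag: "\<And>i. i < n \<Longrightarrow> J i i = 0"
    and near: "\<And>x. x \<in> cube n \<Longrightarrow>
      (\<Sum>i<n. \<bar>local_field n J x i - \<beta> * cavity_mag n x i\<bar>) \<le> real n * \<eta>"
begin

text \<open>
  Inserting \<open>\<psi>\<close> at the cavity magnetization makes the Stein identity of the Gibbs measure
  applicable; on the support of \<open>\<psi>\<close> the two update rules differ only by the fields.
\<close>
lemma stein_bound:
  assumes h: "lipschitz_coord n K h" and K: "K \<ge> 0"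
    and \<psi>: "\<And>m. 0 \<le> \<psi> m" "\<And>m. \<psi> m \<le> 1" "\<And>a b. \<bar>\<psi> a - \<psi> b\<bar> \<le> \<Lambda> * \<bar>a - b\<bar>"
    and \<tau>: "\<And>m. \<bar>\<tau> m\<bar> \<le> 1" "\<And>m. \<psi> m \<noteq> 0 \<Longrightarrow> \<tau> m = tanh (\<beta> * m)"
  shows "\<bar>gibbs_avg n J (\<lambda>x. \<psi> (mag n x) * (h x - glauber n \<tau> h x))\<bar>
    \<le> K * (\<Lambda> / real n + \<eta> / 2)"
proof -
  define D where "D = (\<lambda>i x. h (x(i := 1)) - h (x(i := -1)))"
  define M where "M = (\<lambda>i x. cavity_mag n x i)"
  define t where "t = (\<lambda>i x. tanh (local_field n J x i))"
  define B where "B = (\<lambda>x. (\<Sum>i<n. (x i - t i x) * (\<psi> (M i x) * D i x)) / (2 * real n))"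
  have D_le: "\<bar>D i x\<bar> \<le> K" if "x \<in> cube n" "i < n" for i x
    using h that by (auto simp: D_def lipschitz_coord_def)
  have \<Lambda>: "\<Lambda> \<ge> 0"
    using \<psi>(3)[of 0 1] by simp
  have "gibbs_avg n J B = 0"
  proof -
    have "gibbs_avg n J (\<lambda>x. (x i - t i x) * (\<psi> (M i x) * D i x)) = 0" if "i < n" for i
      unfolding t_def using that
      by (intro stein_identity sym diag) (auto simp: M_def D_def)
    then show ?thesis
      unfolding B_def gibbs_avg_divide gibbs_avg_sum by simp
  qed
  moreover have "\<bar>\<psi> (mag n x) * (h x - glauber n \<tau> h x) - B x\<bar> \<le> K * (\<Lambda> / real n + \<eta> / 2)"
    if x: "x \<in> cube n" for x
  proof -
    have summand: "\<bar>\<psi> (mag n x) * ((x i - \<tau> (M i x)) * D i x) - (x i - t i x) * (\<psi> (M i x) * D i x)\<bar>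
        \<le> 2 * K * \<Lambda> / real n + K * \<bar>local_field n J x i - \<beta> * M i x\<bar>" if i: "i < n" for i
    proof -
      \<comment> \<open>Two errors: moving the cutoff to the cavity magnetization shifts its
        argument by \<open>1 / n\<close>, and \<tau> sees the Curie-Weiss field in place of the true
        one, where \<open>tanh\<close> is 1-Lipschitz.\<close>
      have eq: "\<psi> (mag n x) * ((x i - \<tau> (M i x)) * D i x) - (x i - t i x) * (\<psi> (M i x) * D i x)
        = (\<psi> (mag n x) - \<psi> (M i x)) * (x i - \<tau> (M i x)) * D i x + \<psi> (M i x) * (t i x - \<tau> (M i x)) * D i x"
        by (simp add: algebra_simps)
      have "\<bar>\<psi> (mag n x) - \<psi> (M i x)\<bar> \<le> \<Lambda> * \<bar>mag n x - M i x\<bar>"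
        by (rule \<psi>(3))
      also have "\<dots> = \<Lambda> / real n"
        using x i by (simp add: M_def cavity_mag_eq)
      finally have 1: "\<bar>\<psi> (mag n x) - \<psi> (M i x)\<bar> \<le> \<Lambda> / real n" .
      have 2: "\<bar>x i - \<tau> (M i x)\<bar> \<le> 2"
        using \<tau>(1)[of "M i x"] cube_abs[OF x i] by linarith
      have "\<bar>\<psi> (M i x) * (t i x - \<tau> (M i x))\<bar> \<le> \<bar>local_field n J x i - \<beta> * M i x\<bar>"
      proof (cases "\<psi> (M i x) = 0")
        case False
        then have "\<bar>t i x - \<tau> (M i x)\<bar> \<le> \<bar>local_field n J x i - \<beta> * M i x\<bar>"
          using abs_tanh_diff_le by (simp add: \<tau>(2) t_def)
        then have "\<bar>\<psi> (M i x)\<bar> * \<bar>t i x - \<tau> (M i x)\<bar> \<le> 1 * \<bar>local_field n J x i - \<beta> * M i x\<bar>"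
          using \<psi>(1,2) by (intro mult_mono) auto
        then show ?thesis by (simp add: abs_mult)
      qed auto
      then have "\<bar>\<psi> (M i x) * (t i x - \<tau> (M i x)) * D i x\<bar> \<le> \<bar>local_field n J x i - \<beta> * M i x\<bar> * K"
        unfolding abs_mult[of _ "D i x"] using D_le[OF x i] by (intro mult_mono) auto
      moreover have "\<bar>(\<psi> (mag n x) - \<psi> (M i x)) * (x i - \<tau> (M i x)) * D i x\<bar> \<le> \<Lambda> / real n * 2 * K"
        unfolding abs_mult using 1 2 D_le[OF x i] \<Lambda> by (intro mult_mono) auto
      ultimately show ?thesis
        unfolding eq by (simp add: mult_ac)
    qed
    have eq: "\<psi> (mag n x) * (h x - glauber n \<tau> h x) - B x =
       (\<Sum>i<n. \<psi> (mag n x) * ((x i - \<tau> (M i x)) * D i x) - (x i - t i x) * (\<psi> (M i x) * D i x)) / (2 * real n)"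
      unfolding diff_glauber[OF x n_pos] B_def D_def M_def
      by (simp add: sum_subtractf diff_divide_distrib sum_distrib_left)
    have "\<bar>\<psi> (mag n x) * (h x - glauber n \<tau> h x) - B x\<bar>
        \<le> (\<Sum>i<n. 2 * K * \<Lambda> / real n + K * \<bar>local_field n J x i - \<beta> * M i x\<bar>) / (2 * real n)"
      unfolding eq abs_divide
      by (intro frac_le order_trans[OF sum_abs sum_mono]) (use n_pos summand K \<Lambda> in \<open>auto intro!: sum_nonneg\<close>)
    also have "\<dots> = K * \<Lambda> / real n + K * (\<Sum>i<n. \<bar>local_field n J x i - \<beta> * M i x\<bar>) / (2 * real n)"
    proof -
      have "(\<Sum>i<n. 2 * K * \<Lambda> / real n + K * \<bar>local_field n J x i - \<beta> * M i x\<bar>)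
          = real n * (2 * K * \<Lambda> / real n) + K * (\<Sum>i<n. \<bar>local_field n J x i - \<beta> * M i x\<bar>)"
        by (simp only: sum.distrib sum_distrib_left sum_constant card_lessThan)
      then show ?thesis
        using n_pos by (simp only: add_divide_distrib) simp
    qed
    also have "\<dots> \<le> K * \<Lambda> / real n + K * (real n * \<eta>) / (2 * real n)"
      using near[OF x] K n_pos unfolding M_def
      by (intro add_left_mono divide_right_mono mult_left_mono) auto
    also have "\<dots> = K * (\<Lambda> / real n + \<eta> / 2)"
      using n_pos by (simp add: field_simps)
    finally show ?thesis .
  qed
  then have "\<bar>gibbs_avg n J (\<lambda>x. \<psi> (mag n x) * (h x - glauber n \<tau> h x) - B x)\<bar>
      \<le> gibbs_avg n J (\<lambda>x. K * (\<Lambda> / real n + \<eta> / 2))"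
    by (rule abs_gibbs_avg_le)
  ultimately show ?thesis
    by (simp add: gibbs_avg_diff gibbs_avg_const)
qed

text \<open>With exact Curie-Weiss fields the sum of \<open>x i * cavity_mag n x i\<close> is
  \<open>n * M ^ 2 - 1\<close>, the 1 being the omitted self-interactions. Spins have modulus 1, so
  the field errors enter without amplification.\<close>

lemma energy_near:
  assumes x: "x \<in> cube n"
  shows "\<bar>energy n J x - \<beta> / 2 * (real n * mag n x ^ 2 - 1)\<bar> \<le> real n * \<eta> / 2"
proof -
  have "(\<Sum>i<n. x i * cavity_mag n x i) = (\<Sum>i<n. mag n x * x i - (x i * x i) / real n)"
    by (intro sum.cong) (auto simp: cavity_mag_eq algebra_simps)
  also have "\<dots> = (\<Sum>i<n. mag n x * x i - 1 / real n)"
    using x by (intro sum.cong) (auto simp: cube_square)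
  also have "\<dots> = mag n x * (\<Sum>i<n. x i) - 1"
    using n_pos by (simp add: sum_subtractf sum_distrib_left)
  also have "\<dots> = real n * mag n x ^ 2 - 1"
    using n_pos by (simp add: mag_def power2_eq_square)
  finally have 1: "(\<Sum>i<n. x i * cavity_mag n x i) = real n * mag n x ^ 2 - 1" .
  have 2: "(\<Sum>i<n. x i * (local_field n J x i - \<beta> * cavity_mag n x i))
      = (\<Sum>i<n. x i * local_field n J x i) - \<beta> * (\<Sum>i<n. x i * cavity_mag n x i)"
    by (simp add: right_diff_distrib sum_subtractf sum_distrib_left mult.left_commute)
  have 3: "energy n J x - \<beta> / 2 * (real n * mag n x ^ 2 - 1)
      = 1 / 2 * (\<Sum>i<n. x i * (local_field n J x i - \<beta> * cavity_mag n x i))"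
    unfolding energy_def 2 1 by (simp add: algebra_simps)
  have "\<bar>\<Sum>i<n. x i * (local_field n J x i - \<beta> * cavity_mag n x i)\<bar>
      \<le> (\<Sum>i<n. \<bar>local_field n J x i - \<beta> * cavity_mag n x i\<bar>)"
    by (rule order_trans[OF sum_abs]) (use x in \<open>simp add: abs_mult\<close>)
  with near[OF x] show ?thesis
    unfolding 3 by simp
qed

text \<open>
  Linearizing \<open>M\<^sup>2 \<ge> 2 m M - m\<^sup>2\<close> bounds the partition function from below by a product measure;
  summing the same tilts over the attainable values of \<open>M\<close>, where equality holds, bounds the
  numerator from above.
\<close>
lemma small_mag_unlikely:
  assumes inc: "\<And>m. \<lbrakk>0 < m; m \<le> m\<^sub>2\<rbrakk> \<Longrightarrow> m < tanh (\<beta> * m)" and m: "0 < m\<^sub>1" "m\<^sub>1 < m\<^sub>2"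
  shows "gibbs_avg n J (\<lambda>x. of_bool (\<bar>mag n x\<bar> < m\<^sub>1))
    \<le> (2 * real n + 1) * exp (real n * \<eta>) * (tilt \<beta> m\<^sub>1 / tilt \<beta> m\<^sub>2) ^ n"
proof -
  \<comment> \<open>\<open>e m\<close> is a product weight of computable total mass and
    \<open>q\<close> is the Curie-Weiss weight up to a constant factor;
    \<open>e m x \<le> q x\<close>, with equality when \<open>m\<close> is the magnetization of
    \<open>x\<close>.\<close>
  define e where "e = (\<lambda>m x. exp (\<beta> * m * (\<Sum>i<n. x i) - real n * (\<beta> * m ^ 2 / 2)))"
  define q where "q = (\<lambda>x. exp (\<beta> / 2 * real n * mag n x ^ 2))"
  have sum_e: "(\<Sum>x\<in>cube n. e m x) = tilt \<beta> m ^ n" for m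
  proof -
    have "(\<Sum>x\<in>cube n. e m x) = (\<Sum>x\<in>cube n. exp (\<beta> * m * (\<Sum>i<n. x i)) * exp (- (real n * (\<beta> * m ^ 2 / 2))))"
      unfolding e_def by (intro sum.cong refl) (simp add: exp_add[symmetric])
    also have "\<dots> = (2 * cosh (\<beta> * m)) ^ n * exp (- (real n * (\<beta> * m ^ 2 / 2)))"
      unfolding sum_distrib_right[symmetric] sum_cube_exp ..
    also have "exp (- (real n * (\<beta> * m ^ 2 / 2))) = exp (- (\<beta> * m ^ 2 / 2)) ^ n"
      unfolding exp_of_nat_mult[symmetric] by simp
    finally show ?thesis
      by (simp add: tilt_def power_mult_distrib)
  qed
  have sum_eq: "(\<Sum>i<n. x i) = real n * mag n x" for x
    using n_pos by (simp add: mag_def)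
  have e_le_q: "e m x \<le> q x" for m x
  proof -
    have "0 \<le> \<beta> / 2 * real n * (mag n x - m) ^ 2"
      using \<beta>_pos by simp
    then show ?thesis
      unfolding e_def q_def sum_eq by (simp add: power2_eq_square algebra_simps)
  qed
  have q_eq_e: "q x = e (mag n x) x" for x
    unfolding e_def q_def sum_eq by (simp add: power2_eq_square algebra_simps)
  \<comment> \<open>Candidates for \<open>n * M\<close> with
    \<open>\<bar>M\<bar> < m\<^sub>1\<close>. For such a configuration \<open>q x\<close> is one of
    the summands of \<open>e\<close> over \<open>I\<close>, and the others are nonnegative.\<close>
  define I where "I = {s \<in> {- int n..int n}. \<bar>of_int s / real n\<bar> < m\<^sub>1}"
  have I: "finite I" "real (card I) \<le> 2 * real n + 1"
  proof -
    show "finite I"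
      unfolding I_def by (rule finite_subset[of _ "{- int n..int n}"]) auto
    have "card I \<le> card {- int n..int n}"
      unfolding I_def by (intro card_mono) auto
    then show "real (card I) \<le> 2 * real n + 1" by simp
  qed
  have q_le: "q x * of_bool (\<bar>mag n x\<bar> < m\<^sub>1) \<le> (\<Sum>s\<in>I. e (of_int s / real n) x)" if x: "x \<in> cube n" for x
  proof (cases "\<bar>mag n x\<bar> < m\<^sub>1")
    case True
    obtain s where s: "(\<Sum>i<n. x i) = of_int s" "s \<in> {- int n..int n}"
      using sum_cube_int[OF x] .
    then have ms: "mag n x = of_int s / real n"
      by (simp add: mag_def)
    then have "s \<in> I"
      using s True by (simp add: I_def)
    then have "e (of_int s / real n) x \<le> (\<Sum>s\<in>I. e (of_int s / real n) x)"
      using I by (intro member_le_sum) (auto simp: e_def)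
    then show ?thesis
      using True q_eq_e[of x] ms by simp
  qed (auto simp: e_def intro!: sum_nonneg)
  have energy_bounds:
    "- (\<beta> / 2) - real n * \<eta> / 2 + \<beta> / 2 * real n * mag n x ^ 2 \<le> energy n J x"
    "energy n J x \<le> - (\<beta> / 2) + real n * \<eta> / 2 + \<beta> / 2 * real n * mag n x ^ 2" if "x \<in> cube n" for x
    using energy_near[OF that, unfolded abs_le_iff] by (auto simp: algebra_simps)
  define Z where "Z = (\<Sum>x\<in>cube n. exp (energy n J x))"
  have lower: "exp (- (\<beta> / 2) - real n * \<eta> / 2) * tilt \<beta> m\<^sub>2 ^ n \<le> Z"
    unfolding Z_def sum_e[symmetric] sum_distrib_left
  proof (intro sum_mono)
    fix x assume x: "x \<in> cube n"
    have "exp (- (\<beta> / 2) - real n * \<eta> / 2) * e m\<^sub>2 x \<le> exp (- (\<beta> / 2) - real n * \<eta> / 2) * q x"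
      using e_le_q by simp
    also have "\<dots> \<le> exp (energy n J x)"
      unfolding q_def exp_add[symmetric] using energy_bounds(1)[OF x] by simp
    finally show "exp (- (\<beta> / 2) - real n * \<eta> / 2) * e m\<^sub>2 x \<le> exp (energy n J x)" .
  qed
  have "(\<Sum>x\<in>cube n. exp (energy n J x) * of_bool (\<bar>mag n x\<bar> < m\<^sub>1))
      \<le> (\<Sum>x\<in>cube n. exp (- (\<beta> / 2) + real n * \<eta> / 2) * (\<Sum>s\<in>I. e (of_int s / real n) x))"
  proof (intro sum_mono)
    fix x assume x: "x \<in> cube n"
    have "exp (energy n J x) \<le> exp (- (\<beta> / 2) + real n * \<eta> / 2) * q x"
      unfolding q_def exp_add[symmetric] using energy_bounds(2)[OF x] by simp
    then have "exp (energy n J x) * of_bool (\<bar>mag n x\<bar> < m\<^sub>1)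
        \<le> exp (- (\<beta> / 2) + real n * \<eta> / 2) * q x * of_bool (\<bar>mag n x\<bar> < m\<^sub>1)"
      by (intro mult_right_mono) auto
    also have "\<dots> \<le> exp (- (\<beta> / 2) + real n * \<eta> / 2) * (\<Sum>s\<in>I. e (of_int s / real n) x)"
      unfolding mult.assoc by (intro mult_left_mono q_le x) auto
    finally show "exp (energy n J x) * of_bool (\<bar>mag n x\<bar> < m\<^sub>1) \<le> \<dots>" .
  qed
  also have "\<dots> = exp (- (\<beta> / 2) + real n * \<eta> / 2) * (\<Sum>s\<in>I. tilt \<beta> (of_int s / real n) ^ n)"
    unfolding sum_distrib_left[symmetric] by (subst sum.swap) (simp add: sum_e)
  also have "\<dots> \<le> exp (- (\<beta> / 2) + real n * \<eta> / 2) * (\<Sum>s\<in>I. tilt \<beta> m\<^sub>1 ^ n)"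
  proof (intro mult_left_mono sum_mono power_mono)
    fix s assume s: "s \<in> I"
    \<comment> \<open>Evenness of the tilt reduces to nonnegative magnetizations, where it increases
      up to \<open>m\<^sub>2\<close>.\<close>
    have "tilt \<beta> (of_int s / real n) = tilt \<beta> \<bar>of_int s / real n\<bar>"
      by (cases "of_int s / real n \<ge> (0::real)") (auto simp: abs_if)
    also have "\<dots> \<le> tilt \<beta> m\<^sub>1"
      using s m by (intro less_imp_le[OF tilt_mono[OF \<beta>_pos inc]]) (auto simp: I_def)
    finally show "tilt \<beta> (of_int s / real n) \<le> tilt \<beta> m\<^sub>1" .
  qed (auto simp: tilt_pos less_imp_le)
  also have "\<dots> \<le> exp (- (\<beta> / 2) + real n * \<eta> / 2) * ((2 * real n + 1) * tilt \<beta> m\<^sub>1 ^ n)"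
    using I tilt_pos by (simp add: mult_right_mono less_imp_le)
  finally have upper: "(\<Sum>x\<in>cube n. exp (energy n J x) * of_bool (\<bar>mag n x\<bar> < m\<^sub>1))
    \<le> exp (- (\<beta> / 2) + real n * \<eta> / 2) * ((2 * real n + 1) * tilt \<beta> m\<^sub>1 ^ n)" .
  have "gibbs_avg n J (\<lambda>x. of_bool (\<bar>mag n x\<bar> < m\<^sub>1))
      = (\<Sum>x\<in>cube n. exp (energy n J x) * of_bool (\<bar>mag n x\<bar> < m\<^sub>1)) / Z"
    by (simp add: gibbs_avg_def gibbs_prob_def Z_def sum_divide_distrib)
  also have "\<dots> \<le> exp (- (\<beta> / 2) + real n * \<eta> / 2) * ((2 * real n + 1) * tilt \<beta> m\<^sub>1 ^ n)
      / (exp (- (\<beta> / 2) - real n * \<eta> / 2) * tilt \<beta> m\<^sub>2 ^ n)"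
    using upper lower tilt_pos by (intro frac_le) (auto intro!: mult_nonneg_nonneg simp: less_imp_le)
  also have "\<dots> = (2 * real n + 1) * (exp (- (\<beta> / 2) + real n * \<eta> / 2) / exp (- (\<beta> / 2) - real n * \<eta> / 2))
      * (tilt \<beta> m\<^sub>1 / tilt \<beta> m\<^sub>2) ^ n"
    by (simp add: power_divide)
  \<comment> \<open>The energy errors of numerator and denominator, \<open>n * \<eta> / 2\<close>
    each, add up, while \<open>\<beta> / 2\<close> cancels.\<close>
  also have "exp (- (\<beta> / 2) + real n * \<eta> / 2) / exp (- (\<beta> / 2) - real n * \<eta> / 2) = exp (real n * \<eta>)"
    unfolding exp_diff[symmetric] by simp
  finally show ?thesis .
qed

text \<open>Where \<open>\<bar>M\<bar> \<ge> m\<^sub>1\<close>, the cutoffs at \<open>M\<close> and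
  \<open>- M\<close> add up to 1. Evenness of \<open>f\<close> makes both contribute equally, and
  each contribution is controlled by \<open>stein_bound\<close> and the Poisson error \<delta>. The
  rest lives on small magnetizations, where \<open>\<bar>f x - c\<bar> \<le> 2\<close>.\<close>

lemma even_avg_near_const:
  assumes m: "0 < m\<^sub>0" "m\<^sub>0 < m\<^sub>1"
    and f: "\<And>x. x \<in> cube n \<Longrightarrow> f (flip_all n x) = f x" "\<And>x. x \<in> cube n \<Longrightarrow> \<bar>f x\<bar> \<le> 1"
    and h: "lipschitz_coord n K h" and K: "K \<ge> 0" and c: "\<bar>c\<bar> \<le> 1"
    and poisson: "\<And>x. x \<in> cube n \<Longrightarrow>
      \<bar>(h x - glauber n (clamped_response \<beta> m\<^sub>0) h x) - (f x - c)\<bar> \<le> \<delta>"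
  shows "\<bar>gibbs_avg n J f - c\<bar> \<le> 2 * K * (1 / ((m\<^sub>1 - m\<^sub>0) * real n) + \<eta> / 2) + 2 * \<delta>
    + 2 * gibbs_avg n J (\<lambda>x. of_bool (\<bar>mag n x\<bar> < m\<^sub>1))"
proof -
  define \<psi> where "\<psi> = cutoff m\<^sub>0 m\<^sub>1"
  define G where "G = (\<lambda>x. h x - glauber n (clamped_response \<beta> m\<^sub>0) h x)"
  have \<psi>: "0 \<le> \<psi> a" "\<psi> a \<le> 1" for a
    by (auto simp: \<psi>_def cutoff_bounds)
  have "\<bar>gibbs_avg n J (\<lambda>x. \<psi> (mag n x) * (h x - glauber n (clamped_response \<beta> m\<^sub>0) h x))\<bar>
      \<le> K * (1 / (m\<^sub>1 - m\<^sub>0) / real n + \<eta> / 2)"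
  proof (rule stein_bound[OF h K \<psi>])
    show "\<bar>\<psi> a - \<psi> b\<bar> \<le> 1 / (m\<^sub>1 - m\<^sub>0) * \<bar>a - b\<bar>" for a b
      using cutoff_lipschitz[OF m(2)] by (simp add: \<psi>_def)
    show "\<bar>clamped_response \<beta> m\<^sub>0 a\<bar> \<le> 1" for a
      by (rule abs_clamped_response_le_1)
    show "clamped_response \<beta> m\<^sub>0 a = tanh (\<beta> * a)" if "\<psi> a \<noteq> 0" for a
      using that cutoff_eq_0[OF m(2), of a] by (cases "a \<le> m\<^sub>0") (auto simp: \<psi>_def clamped_response_def)
  qed
  then have 1: "\<bar>gibbs_avg n J (\<lambda>x. \<psi> (mag n x) * G x)\<bar> \<le> K * (1 / ((m\<^sub>1 - m\<^sub>0) * real n) + \<eta> / 2)"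
    by (simp add: G_def)
  have "\<bar>gibbs_avg n J (\<lambda>x. \<psi> (mag n x) * (f x - c) - \<psi> (mag n x) * G x)\<bar> \<le> gibbs_avg n J (\<lambda>x. \<delta>)"
  proof (rule abs_gibbs_avg_le)
    fix x assume x: "x \<in> cube n"
    have "\<bar>\<psi> (mag n x) * (f x - c) - \<psi> (mag n x) * G x\<bar> = \<psi> (mag n x) * \<bar>(f x - c) - G x\<bar>"
      unfolding right_diff_distrib[symmetric] using \<psi> by (simp add: abs_mult)
    also have "\<dots> \<le> 1 * \<delta>"
      using \<psi> poisson[OF x] by (intro mult_mono) (auto simp: G_def abs_minus_commute)
    finally show "\<bar>\<psi> (mag n x) * (f x - c) - \<psi> (mag n x) * G x\<bar> \<le> \<delta>" by simp
  qed
  with 1 have 2: "\<bar>gibbs_avg n J (\<lambda>x. \<psi> (mag n x) * (f x - c))\<bar>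
      \<le> K * (1 / ((m\<^sub>1 - m\<^sub>0) * real n) + \<eta> / 2) + \<delta>"
    unfolding gibbs_avg_diff[where F = "\<lambda>x. \<psi> (mag n x) * (f x - c)"] gibbs_avg_const by linarith
  have "gibbs_avg n J (\<lambda>x. \<psi> (- mag n x) * (f x - c))
      = gibbs_avg n J (\<lambda>x. \<psi> (mag n (flip_all n x)) * (f (flip_all n x) - c))"
    by (intro gibbs_avg_cong) (simp add: f mag_flip_all)
  also have "\<dots> = gibbs_avg n J (\<lambda>x. \<psi> (mag n x) * (f x - c))"
    by (rule gibbs_avg_flip_all)
  finally have 3: "gibbs_avg n J (\<lambda>x. \<psi> (- mag n x) * (f x - c)) = \<dots>" .
  have "\<bar>gibbs_avg n J (\<lambda>x. (f x - c) - (\<psi> (mag n x) * (f x - c) + \<psi> (- mag n x) * (f x - c)))\<bar>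
      \<le> gibbs_avg n J (\<lambda>x. 2 * of_bool (\<bar>mag n x\<bar> < m\<^sub>1))"
  proof (rule abs_gibbs_avg_le)
    fix x assume x: "x \<in> cube n"
    let ?m = "mag n x"
    have s: "\<bar>1 - (\<psi> ?m + \<psi> (- ?m))\<bar> \<le> of_bool (\<bar>?m\<bar> < m\<^sub>1)"
    proof (cases "\<bar>?m\<bar> < m\<^sub>1")
      case True
      have "\<psi> ?m = 0 \<or> \<psi> (- ?m) = 0"
        using m cutoff_eq_0[OF m(2)] by (cases "?m \<le> 0") (auto simp: \<psi>_def)
      then show ?thesis
        using True \<psi>[of ?m] \<psi>[of "- ?m"] by auto
    next
      case False
      then consider "?m \<ge> m\<^sub>1" | "- ?m \<ge> m\<^sub>1" by linarith
      then have "\<psi> ?m + \<psi> (- ?m) = 1"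
      proof cases
        case 1
        then show ?thesis
          using m cutoff_eq_0[OF m(2), of "- ?m"] cutoff_eq_1[OF m(2), of ?m] by (simp add: \<psi>_def)
      next
        case 2
        then show ?thesis
          using m cutoff_eq_0[OF m(2), of ?m] cutoff_eq_1[OF m(2), of "- ?m"] by (simp add: \<psi>_def)
      qed
      then show ?thesis by simp
    qed
    have "(f x - c) - (\<psi> ?m * (f x - c) + \<psi> (- ?m) * (f x - c)) = (f x - c) * (1 - (\<psi> ?m + \<psi> (- ?m)))"
      by (simp add: algebra_simps)
    also have "\<bar>\<dots>\<bar> \<le> 2 * of_bool (\<bar>?m\<bar> < m\<^sub>1)"
      unfolding abs_mult using s f(2)[OF x] c by (intro mult_mono) auto
    finally show "\<bar>(f x - c) - (\<psi> ?m * (f x - c) + \<psi> (- ?m) * (f x - c))\<bar> \<le> 2 * of_bool (\<bar>?m\<bar> < m\<^sub>1)" .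
  qed
  then have "\<bar>(gibbs_avg n J f - c) - 2 * gibbs_avg n J (\<lambda>x. \<psi> (mag n x) * (f x - c))\<bar>
      \<le> 2 * gibbs_avg n J (\<lambda>x. of_bool (\<bar>mag n x\<bar> < m\<^sub>1))"
    unfolding gibbs_avg_diff[where F = "\<lambda>x. f x - c"] gibbs_avg_diff[where F = f]
      gibbs_avg_add 3 gibbs_avg_const gibbs_avg_cmult by simp
  with 2 show ?thesis by linarith
qed

end


section \<open>Spectral bound for expanders\<close>

lemma local_field_lincomb:
  "local_field n B (\<lambda>i. u i + t * w i) i = local_field n B u i + t * local_field n B w i"
  by (simp add: local_field_def algebra_simps sum.distrib sum_distrib_left)

lemma local_field_cong:
  "(\<And>i. i < n \<Longrightarrow> u i = w i) \<Longrightarrow> local_field n B u i = local_field n B w i"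
  by (simp add: local_field_def)

lemma local_field_symmetric:
  assumes "\<And>i j. i < n \<Longrightarrow> j < n \<Longrightarrow> B i j = B j i"
  shows "(\<Sum>i<n. local_field n B u i * w i) = (\<Sum>i<n. u i * local_field n B w i)"
proof -
  have "(\<Sum>i<n. local_field n B u i * w i) = (\<Sum>i<n. \<Sum>j<n. B i j * u j * w i)"
    by (simp add: local_field_def sum_distrib_right)
  also have "\<dots> = (\<Sum>j<n. \<Sum>i<n. B i j * u j * w i)"
    by (rule sum.swap)
  also have "\<dots> = (\<Sum>j<n. \<Sum>i<n. u j * (B j i * w i))"
    using assms by (intro sum.cong refl) auto
  finally show ?thesis
    by (simp add: local_field_def sum_distrib_left)
qed

text \<open>
  The quadratic form of \<open>B\<^sup>2\<close> on the unit sphere of \<open>\<one>\<^sup>\<bottom>\<close> is maximal at an eigenvector \<open>v\<close>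
  of \<open>B\<^sup>2\<close>, say \<open>B\<^sup>2 v = \<lambda>\<^sup>2 v\<close>; then \<open>B v + \<lambda> v\<close> is an eigenvector of \<open>B\<close> for \<open>\<lambda>\<close>, or it
  vanishes and \<open>v\<close> is one for \<open>- \<lambda>\<close>.
\<close>
lemma norm_bound_orthogonal_to_ones:
  fixes B :: "nat \<Rightarrow> nat \<Rightarrow> real"
  assumes sym: "\<And>i j. i < n \<Longrightarrow> j < n \<Longrightarrow> B i j = B j i"
    and rows: "\<And>i. i < n \<Longrightarrow> (\<Sum>j<n. B i j) = r"
    and eig: "\<And>l v. \<lbrakk>\<exists>i<n. v i \<noteq> 0; (\<Sum>i<n. v i) = 0; \<And>i. i < n \<Longrightarrow> local_field n B v i = l * v i\<rbrakk>
      \<Longrightarrow> \<bar>l\<bar> \<le> b"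
    and y: "(\<Sum>i<n. y i) = 0"
  shows "(\<Sum>i<n. local_field n B y i ^ 2) \<le> b ^ 2 * (\<Sum>i<n. y i ^ 2)"
proof -
  define A where "A = local_field n B"
  define S where "S = (\<lambda>v::nat \<Rightarrow> real. \<Sum>i<n. v i ^ 2)"
  \<comment> \<open>Coordinates from \<open>n\<close> on are pinned to 0, so that the unit sphere
    becomes a closed subset of a compact product inside
    \<open>nat \<Rightarrow> real\<close>.\<close>
  define T where "T = (\<lambda>i. if i < n then {-1..1} else {0 :: real})"
  define K where "K = PiE UNIV T \<inter> ({v. S v = 1} \<inter> {v. (\<Sum>i<n. v i) = 0})"
  have S_apply: "S v = (\<Sum>i<n. v i ^ 2)" for v
    by (simp add: S_def)
  have S_nonneg: "S v \<ge> 0" for v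
    by (auto simp: S_def intro: sum_nonneg)
  have S_eq_0: "S v = 0 \<longleftrightarrow> (\<forall>i<n. v i = 0)" for v
    by (auto simp: S_def sum_nonneg_eq_0_iff)
  have A_orth: "(\<Sum>i<n. A v i) = 0" if "(\<Sum>i<n. v i) = 0" for v
  proof -
    have "(\<Sum>i<n. A v i) = (\<Sum>i<n. v i * local_field n B (\<lambda>_. 1) i)"
      using local_field_symmetric[OF sym, where u = v and w = "\<lambda>_. 1"] by (simp add: A_def)
    also have "\<dots> = (\<Sum>i<n. v i * r)"
      by (intro sum.cong) (auto simp: local_field_def rows)
    finally show ?thesis
      using that by (simp add: sum_distrib_right[symmetric])
  qed
  have cont: "continuous_on UNIV S" "continuous_on UNIV (\<lambda>v. S (A v))"
    "continuous_on UNIV (\<lambda>v::nat \<Rightarrow> real. \<Sum>i<n. v i)"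
    unfolding S_def A_def local_field_def by (intro continuous_intros; simp)+
  have compact: "compact K"
  proof -
    have "compactin (product_topology (\<lambda>_. euclidean) UNIV) (PiE UNIV T)"
      by (subst compactin_PiE) (auto simp: T_def compactin_euclidean_iff)
    then have "compact (PiE UNIV T)"
      by (simp only: euclidean_product_topology compactin_euclidean_iff)
    then show ?thesis
      unfolding K_def by (intro compact_Int_closed closed_Int closed_Collect_eq cont continuous_on_const)
  qed
  have normalize: "\<exists>v\<in>K. \<forall>i<n. v i = inverse (sqrt (S w)) * w i"
    if w: "(\<Sum>i<n. w i) = 0" "S w \<noteq> 0" for w
  proof
    let ?v = "\<lambda>i. if i < n then inverse (sqrt (S w)) * w i else 0"
    have Sw: "S w > 0"
      using S_nonneg[of w] w by simp
    have "S ?v = (\<Sum>i<n. inverse (S w) * w i ^ 2)"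
      unfolding S_apply[of ?v] using Sw by (intro sum.cong) (auto simp: power_mult_distrib power_inverse)
    also have "\<dots> = 1"
      using Sw by (simp add: sum_distrib_left[symmetric] S_apply[symmetric])
    finally have S1: "S ?v = 1" .
    have "\<bar>?v i\<bar> \<le> 1" if "i < n" for i
    proof -
      have "?v i ^ 2 \<le> S ?v"
        unfolding S_def using that by (intro member_le_sum) auto
      then show ?thesis
        using S1 by (simp only: abs_square_le_1)
    qed
    then have range: "?v i \<in> {-1..1}" if "i < n" for i
      using that by (fastforce simp: abs_le_iff)
    have "(\<Sum>i<n. ?v i) = 0"
      using w by (simp add: sum_distrib_left[symmetric])
    then show "?v \<in> K"
      unfolding K_def using S1 range by (auto simp: T_def PiE_iff)
  qed auto
  show ?thesis
  proof (cases "S y = 0")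
    case True
    then have "A y i = 0" for i
      by (simp add: A_def local_field_def S_eq_0)
    then show ?thesis
      using S_nonneg[of y] by (simp add: A_def S_def)
  next
    case False
    then have "K \<noteq> {}"
      using normalize[OF y] by blast
    then obtain v where v: "v \<in> K" and vmax: "\<And>w. w \<in> K \<Longrightarrow> S (A w) \<le> S (A v)"
      using continuous_attains_sup[OF compact _ continuous_on_subset[OF cont(2)]] by auto
    define \<Lambda> where "\<Lambda> = S (A v)"
    have v0: "(\<Sum>i<n. v i) = 0" "S v = 1"
      using v by (auto simp: K_def)
    have \<Lambda>: "\<Lambda> \<ge> 0"
      unfolding \<Lambda>_def by (rule S_nonneg)
    have bound: "S (A w) \<le> \<Lambda> * S w" if w: "(\<Sum>i<n. w i) = 0" for w
    proof (cases "S w = 0")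
      case True
      then have "A w i = 0" for i
        by (simp add: A_def local_field_def S_eq_0)
      then show ?thesis
        using True by (simp add: S_def)
    next
      case False
      then have Sw: "S w > 0"
        using S_nonneg[of w] by simp
      obtain w' where w': "w' \<in> K" "\<And>i. i < n \<Longrightarrow> w' i = 0 + inverse (sqrt (S w)) * w i"
        using normalize[OF w False] by auto
      have "A w' i = 0 + inverse (sqrt (S w)) * A w i" for i
      proof -
        have "A w' i = local_field n B (\<lambda>i. 0 + inverse (sqrt (S w)) * w i) i"
          unfolding A_def by (intro local_field_cong w'(2))
        also have "\<dots> = local_field n B (\<lambda>_. 0) i + inverse (sqrt (S w)) * A w i"
          unfolding A_def by (rule local_field_lincomb)
        also have "local_field n B (\<lambda>_. 0) i = 0"
          by (simp add: local_field_def)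
        finally show ?thesis .
      qed
      then have "S (A w') = (\<Sum>i<n. inverse (S w) * A w i ^ 2)"
        unfolding S_apply[of "A w'"] using Sw by (intro sum.cong) (auto simp: power_mult_distrib power_inverse)
      also have "\<dots> = S (A w) / S w"
        by (simp add: sum_distrib_left[symmetric] S_apply[symmetric] divide_inverse mult.commute)
      finally show ?thesis
        using vmax[OF w'(1)] Sw by (simp add: \<Lambda>_def divide_le_eq)
    qed
    \<comment> \<open>The residual of the eigenvector equation for the square of \<open>A\<close>.
      Its entries sum to 0, so the maximizer \<open>v\<close> may be perturbed in this
      direction.\<close>
    define u where "u = (\<lambda>i. A (A v) i + (- \<Lambda>) * v i)"
    have u0: "(\<Sum>i<n. u i) = 0"
      using A_orth[OF A_orth[OF v0(1)]] v0 by (simp add: u_def sum.distrib sum_subtractf sum_distrib_left[symmetric])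
    have S_lincomb: "S (\<lambda>i. p i + t * q i) = S p + t * (2 * (\<Sum>i<n. p i * q i)) + t ^ 2 * S q" for p q t
      by (simp add: S_def power2_eq_square algebra_simps sum.distrib sum_distrib_left)
    have "S u = 0"
    proof (rule ccontr)
      assume "S u \<noteq> 0"
      then have Su: "S u > 0"
        using S_nonneg[of u] by simp
      define Q where "Q = \<Lambda> * S u - S (A u)"
      have Q: "Q \<ge> 0"
        using bound[OF u0] by (simp add: Q_def)
      have "(\<Sum>i<n. A v i * A u i) - \<Lambda> * (\<Sum>i<n. v i * u i) = (\<Sum>i<n. A (A v) i * u i) - \<Lambda> * (\<Sum>i<n. v i * u i)"
        unfolding A_def by (subst local_field_symmetric[where u = "local_field n B v", OF sym]) auto
      also have "\<dots> = S u"
        by (simp add: S_def u_def power2_eq_square algebra_simps sum.distrib sum_subtractf sum_distrib_left)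
      finally have lin: "(\<Sum>i<n. A v i * A u i) = \<Lambda> * (\<Sum>i<n. v i * u i) + S u"
        by simp
      \<comment> \<open>Maximality tested at \<open>v + t * u\<close>: the constant terms agree, and
        the first-order gain \<open>2 * t * S u\<close> is left against a second-order term.\<close>
      have *: "2 * t * S u \<le> t ^ 2 * Q" for t
      proof -
        have "(\<Sum>i<n. v i + t * u i) = 0"
          using v0 u0 by (simp add: sum.distrib sum_distrib_left[symmetric])
        from bound[OF this]
        have "S (\<lambda>i. A v i + t * A u i) \<le> \<Lambda> * S (\<lambda>i. v i + t * u i)"
          unfolding A_def local_field_lincomb .
        then show ?thesis
          unfolding S_lincomb lin v0 Q_def \<Lambda>_def[symmetric] by (simp add: algebra_simps)
      qed
      \<comment> \<open>A step so short that \<open>s * Q < S u\<close>, which contradicts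
        \<open>*\<close>; the added 1 covers \<open>Q = 0\<close>.\<close>
      define s where "s = S u / (Q + 1)"
      have s: "s > 0" "s * Q = S u - s"
        using Q Su by (simp_all add: s_def field_simps)
      have "s * (2 * S u) \<le> s * (s * Q)"
        using *[of s] by (simp add: power2_eq_square mult_ac)
      then have "2 * S u \<le> s * Q"
        using s(1) by (rule mult_left_le_imp_le)
      with s Su show False by simp
    qed
    then have AA: "A (A v) i = \<Lambda> * v i" if "i < n" for i
      using that by (auto simp: S_eq_0 u_def)
    define l where "l = sqrt \<Lambda>"
    have l: "l \<ge> 0" "l * l = \<Lambda>"
      using \<Lambda> by (auto simp: l_def)
    define w where "w = (\<lambda>i. A v i + l * v i)"
    have "l \<le> b"
    proof (cases "\<exists>i<n. w i \<noteq> 0")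
      case True
      moreover have "(\<Sum>i<n. w i) = 0"
        using A_orth[OF v0(1)] v0 by (simp add: w_def sum.distrib sum_distrib_left[symmetric])
      moreover have "local_field n B w i = l * w i" if "i < n" for i
        using AA[OF that] unfolding w_def A_def local_field_lincomb
        by (simp add: algebra_simps l(2)[symmetric])
      ultimately have "\<bar>l\<bar> \<le> b"
        by (rule eig)
      then show ?thesis using l by simp
    next
      case False
      have "\<exists>i<n. v i \<noteq> 0"
        using v0(2) S_eq_0[of v] by auto
      moreover have "local_field n B v i = (- l) * v i" if "i < n" for i
        using False that by (auto simp: w_def A_def add_eq_0_iff)
      ultimately have "\<bar>- l\<bar> \<le> b"
        using v0(1) by (intro eig)
      then show ?thesis using l by simp
    qed
    then have "\<Lambda> \<le> b ^ 2"
      using l by (metis mult_mono power2_eq_square order_trans)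
    then have "\<Lambda> * S y \<le> b ^ 2 * S y"
      using S_nonneg by (intro mult_right_mono)
    then show ?thesis
      using bound[OF y] by (simp add: S_def A_def)
  qed
qed


section \<open>Averages of signed moments\<close>

text \<open>Removing \<open>i\<close> leaves a subset of size \<open>k - 1\<close>, and absorption
  turns the count into a fraction \<open>k / n\<close> of all subsets. This fraction is the source
  of the factor \<open>k\<close> in the final bound.\<close>

lemma card_subsets_containing:
  assumes "i < n" "k > 0"
  shows "real (card {R. R \<subseteq> {..<n} \<and> card R = k \<and> i \<in> R}) = real k / real n * real (n choose k)"
proof -
  have "bij_betw (insert i) {R. R \<subseteq> {..<n} - {i} \<and> card R = k - 1} {R. R \<subseteq> {..<n} \<and> card R = k \<and> i \<in> R}"
  proof (rule bij_betwI[where g = "\<lambda>R. R - {i}"])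
    show "insert i \<in> {R. R \<subseteq> {..<n} - {i} \<and> card R = k - 1} \<rightarrow> {R. R \<subseteq> {..<n} \<and> card R = k \<and> i \<in> R}"
    proof
      fix R assume R: "R \<in> {R. R \<subseteq> {..<n} - {i} \<and> card R = k - 1}"
      then have "finite R" "i \<notin> R"
        using finite_subset[of R "{..<n} - {i}"] by auto
      then show "insert i R \<in> {R. R \<subseteq> {..<n} \<and> card R = k \<and> i \<in> R}"
        using R assms by auto
    qed
  qed auto
  then have "card {R. R \<subseteq> {..<n} \<and> card R = k \<and> i \<in> R} = card {R. R \<subseteq> {..<n} - {i} \<and> card R = k - 1}"
    by (rule bij_betw_same_card[symmetric])
  also have "\<dots> = (n - 1) choose (k - 1)"
    using assms by (subst n_subsets) auto
  finally have "real n * real (card {R. R \<subseteq> {..<n} \<and> card R = k \<and> i \<in> R}) = real (n * ((n - 1) choose (k - 1)))"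
    by simp
  also have "n * ((n - 1) choose (k - 1)) = k * (n choose k)"
    using binomial_absorption[of "k - 1" "n"] assms by simp
  finally show ?thesis
    using assms by (simp add: field_simps)
qed

definition signed_moment_avg :: "nat \<Rightarrow> nat \<Rightarrow> (nat set \<Rightarrow> real) \<Rightarrow> (nat \<Rightarrow> real) \<Rightarrow> real" where
  "signed_moment_avg n k \<sigma> x =
     1 / real (n choose k) * (\<Sum>R | R \<subseteq> {..<n} \<and> card R = k. \<sigma> R * (\<Prod>i\<in>R. x i))"

lemma finite_k_subsets: "finite {R. R \<subseteq> {..<n::nat} \<and> card R = k}"
  by (rule finite_subset[of _ "Pow {..<n}"]) auto

lemma abs_prod_cube: "x \<in> cube n \<Longrightarrow> R \<subseteq> {..<n} \<Longrightarrow> \<bar>\<Prod>i\<in>R. x i\<bar> = 1"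
  by (auto simp: abs_prod intro!: prod.neutral)

lemma signed_moment_avg_le_1:
  assumes \<sigma>: "\<And>R. \<bar>\<sigma> R\<bar> \<le> 1" and x: "x \<in> cube n" and k: "k \<le> n"
  shows "\<bar>signed_moment_avg n k \<sigma> x\<bar> \<le> 1"
proof -
  have "\<bar>\<Sum>R | R \<subseteq> {..<n} \<and> card R = k. \<sigma> R * (\<Prod>i\<in>R. x i)\<bar> \<le> (\<Sum>R | R \<subseteq> {..<n} \<and> card R = k. 1)"
    by (rule order_trans[OF sum_abs sum_mono]) (auto simp: abs_mult abs_prod_cube[OF x] \<sigma>)
  also have "\<dots> = real (n choose k)"
    using n_subsets[of "{..<n}" k] by simp
  finally show ?thesis
    using k by (simp add: signed_moment_avg_def abs_mult divide_le_eq)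
qed

lemma signed_moment_avg_flip_all:
  assumes "even k"
  shows "signed_moment_avg n k \<sigma> (flip_all n x) = signed_moment_avg n k \<sigma> x"
proof -
  have "(\<Prod>i\<in>R. flip_all n x i) = (\<Prod>i\<in>R. x i)" if R: "R \<subseteq> {..<n}" "card R = k" for R
  proof -
    have "(\<Prod>i\<in>R. flip_all n x i) = (\<Prod>i\<in>R. - 1 * x i)"
      using R by (intro prod.cong) (auto simp: flip_all_def)
    also have "\<dots> = (\<Prod>i\<in>R. x i)"
      using R assms by (simp only: prod.distrib prod_constant) simp
    finally show ?thesis .
  qed
  then show ?thesis
    by (simp add: signed_moment_avg_def)
qed

text \<open>Only the subsets containing \<open>i\<close>, a fraction \<open>k / n\<close> of all,
  notice a flip at \<open>i\<close>, and each product changes by at most 2.\<close>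

lemma signed_moment_avg_lipschitz:
  assumes \<sigma>: "\<And>R. \<bar>\<sigma> R\<bar> \<le> 1" and k: "0 < k" "k \<le> n"
  shows "lipschitz_coord n (2 * real k / real n) (signed_moment_avg n k \<sigma>)"
  unfolding lipschitz_coord_def
proof (intro ballI allI impI)
  fix x i assume x: "x \<in> cube n" and i: "i < n"
  let ?\<R> = "{R. R \<subseteq> {..<n} \<and> card R = k}"
  have diff: "\<bar>\<sigma> R * (\<Prod>j\<in>R. (x(i := 1)) j) - \<sigma> R * (\<Prod>j\<in>R. (x(i := -1)) j)\<bar> \<le> 2 * of_bool (i \<in> R)"
    if "R \<in> ?\<R>" for R
  proof (cases "i \<in> R")
    case True
    have "\<bar>\<Prod>j\<in>R. (x(i := s)) j\<bar> = 1" if "s = 1 \<or> s = -1" for s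
      using abs_prod_cube[OF cube_upd[OF x i that]] \<open>R \<in> ?\<R>\<close> by simp
    from this[of 1] this[of "-1"]
    have "\<bar>(\<Prod>j\<in>R. (x(i := 1)) j) - (\<Prod>j\<in>R. (x(i := -1)) j)\<bar> \<le> 2"
      by linarith
    then have "\<bar>\<sigma> R\<bar> * \<bar>(\<Prod>j\<in>R. (x(i := 1)) j) - (\<Prod>j\<in>R. (x(i := -1)) j)\<bar> \<le> 1 * 2"
      using \<sigma> by (intro mult_mono) auto
    then show ?thesis
      using True by (simp add: abs_mult[symmetric] right_diff_distrib)
  next
    case False
    then have "(\<Prod>j\<in>R. (x(i := s)) j) = (\<Prod>j\<in>R. x j)" for s
      by (intro prod.cong) auto
    then show ?thesis by simp
  qed
  have "\<bar>\<Sum>R\<in>?\<R>. \<sigma> R * (\<Prod>j\<in>R. (x(i := 1)) j) - \<sigma> R * (\<Prod>j\<in>R. (x(i := -1)) j)\<bar>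
      \<le> (\<Sum>R\<in>?\<R>. 2 * of_bool (i \<in> R))"
    by (rule order_trans[OF sum_abs sum_mono]) (rule diff)
  also have "\<dots> = 2 * real (card {R. R \<subseteq> {..<n} \<and> card R = k \<and> i \<in> R})"
    using finite_k_subsets by (simp add: sum_distrib_left[symmetric] Int_def conj_assoc)
  also have "\<dots> = 2 * real k / real n * real (n choose k)"
    using card_subsets_containing[OF i k(1)] by simp
  finally have "1 / real (n choose k) * \<bar>\<Sum>R\<in>?\<R>. \<sigma> R * (\<Prod>j\<in>R. (x(i := 1)) j) - \<sigma> R * (\<Prod>j\<in>R. (x(i := -1)) j)\<bar>
      \<le> 1 / real (n choose k) * (2 * real k / real n * real (n choose k))"
    by (intro mult_left_mono) auto
  also have "\<dots> = 2 * real k / real n"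
    using k by simp
  finally show "\<bar>signed_moment_avg n k \<sigma> (x(i := 1)) - signed_moment_avg n k \<sigma> (x(i := -1))\<bar> \<le> 2 * real k / real n"
    unfolding signed_moment_avg_def right_diff_distrib[symmetric] sum_subtractf[symmetric] by (simp add: abs_mult)
qed

section \<open>Measures near the Curie-Weiss model share their even averages\<close>

lemma linear_exp_decay:
  fixes \<Gamma> :: real
  assumes "\<Gamma> > 0" "n > 0"
  shows "(2 * real n + 1) * exp (- (\<Gamma> * real n / 2)) \<le> 24 / \<Gamma> ^ 2 / real n"
proof -
  define y where "y = \<Gamma> * real n / 2"
  have y: "y > 0"
    using assms by (simp add: y_def)
  \<comment> \<open>The quadratic Taylor term beats the linear prefactor by one power of
    \<open>n\<close>, turning exponential smallness into \<open>O(1 / n)\<close>.\<close>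
  have "y ^ 2 / 2 \<le> exp y"
    using exp_lower_Taylor_quadratic[of y] y by simp
  then have "exp (- y) \<le> 2 / y ^ 2"
    using y by (simp add: exp_minus inverse_eq_divide field_simps)
  also have "\<dots> = 8 / \<Gamma> ^ 2 / real n ^ 2"
    by (simp add: y_def power2_eq_square)
  finally have "(2 * real n + 1) * exp (- y) \<le> (3 * real n) * (8 / \<Gamma> ^ 2 / real n ^ 2)"
    using assms by (intro mult_mono) auto
  also have "\<dots> = 24 / \<Gamma> ^ 2 / real n"
    using assms by (simp add: power2_eq_square)
  finally show ?thesis
    by (simp add: y_def)
qed

text \<open>The constant \<open>c\<close> is built from \<open>f\<close> and the clamped kernel
  alone and so precedes \<open>J\<close>: two measures that satisfy the closeness condition are
  compared through \<open>c\<close>, never directly.\<close>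

lemma even_avg_universal:
  fixes \<beta> :: real
  assumes \<beta>: "\<beta> > 1"
  obtains \<epsilon>\<^sub>0 C where "\<epsilon>\<^sub>0 > 0" "C > 0"
    "\<And>n \<epsilon> k f. \<lbrakk>n > 0; 0 < \<epsilon>; \<epsilon> < \<epsilon>\<^sub>0; 0 < k; \<And>x. x \<in> cube n \<Longrightarrow> f (flip_all n x) = f x;
        \<And>x. x \<in> cube n \<Longrightarrow> \<bar>f x\<bar> \<le> 1; lipschitz_coord n (2 * real k / real n) f\<rbrakk>
      \<Longrightarrow> \<exists>c. \<forall>J. near_curie_weiss n \<beta> (\<beta> * (\<epsilon> + 1 / real n)) J
          \<longrightarrow> \<bar>gibbs_avg n J f - c\<bar> \<le> real k * C * (\<epsilon> + 1 / real n)"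
proof -
  obtain m\<^sub>0 m\<^sub>1 m\<^sub>2 where m: "0 < m\<^sub>0" "m\<^sub>0 < m\<^sub>1" "m\<^sub>1 < m\<^sub>2"
    and inc: "\<And>m. \<lbrakk>0 < m; m \<le> m\<^sub>2\<rbrakk> \<Longrightarrow> m < tanh (\<beta> * m)"
    and \<kappa>1: "\<beta> * (1 - tanh (\<beta> * m\<^sub>0) ^ 2) < 1"
    using tanh_thresholds[OF \<beta>] by blast
  define \<kappa> where "\<kappa> = \<beta> * (1 - tanh (\<beta> * m\<^sub>0) ^ 2)"
  have \<kappa>: "\<kappa> < 1"
    using \<kappa>1 by (simp add: \<kappa>_def)
  \<comment> \<open>The exponential rate at which small magnetizations become unlikely, before the
    field error is deducted.\<close>
  define \<Gamma> where "\<Gamma> = - ln (tilt \<beta> m\<^sub>1 / tilt \<beta> m\<^sub>2)"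
  have "tilt \<beta> m\<^sub>1 < tilt \<beta> m\<^sub>2"
    using m \<beta> by (intro tilt_mono[OF _ inc]) auto
  then have "\<Gamma> > 0"
    using tilt_pos[of \<beta>] by (simp add: \<Gamma>_def)
  have q: "tilt \<beta> m\<^sub>1 / tilt \<beta> m\<^sub>2 = exp (- \<Gamma>)"
    using tilt_pos[of \<beta>] by (simp add: \<Gamma>_def)
  \<comment> \<open>In order: the Stein error with \<open>K = 2 * k / (1 - \<kappa>)\<close>, the
    Poisson error \<open>1 / n\<close>, and the probability of a small magnetization.\<close>
  define C where "C = 4 / (1 - \<kappa>) * (1 / (m\<^sub>1 - m\<^sub>0) + \<beta> / 2) + 2 + 2 * (exp \<beta> * (24 / \<Gamma> ^ 2))"
  show ?thesis
  proof
    \<comment> \<open>Below this threshold \<open>n * \<beta> * \<epsilon>\<close> consumes at most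
      half of the rate \<open>n * \<Gamma>\<close>; the \<open>1 / n\<close> part of the field error
      only contributes the factor \<open>exp \<beta>\<close>.\<close>
    show "\<Gamma> / (2 * \<beta>) > 0"
      using \<open>\<Gamma> > 0\<close> \<beta> by simp
    show "C > 0"
      unfolding C_def using m \<kappa> \<beta> by (intro add_pos_nonneg add_nonneg_pos mult_nonneg_nonneg) auto
    fix n k :: nat and \<epsilon> :: real and f
    assume n: "n > 0" and \<epsilon>: "0 < \<epsilon>" "\<epsilon> < \<Gamma> / (2 * \<beta>)" and k: "0 < k"
      and f: "\<And>x. x \<in> cube n \<Longrightarrow> f (flip_all n x) = f x" "\<And>x. x \<in> cube n \<Longrightarrow> \<bar>f x\<bar> \<le> 1"
        "lipschitz_coord n (2 * real k / real n) f"
    define K where "K = real n * (2 * real k / real n) / (1 - \<kappa>)"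
    have K: "K = 2 * real k / (1 - \<kappa>)"
      using n by (simp add: K_def)
    define \<tau> where "\<tau> = clamped_response \<beta> m\<^sub>0"
    obtain h c where h: "lipschitz_coord n K h" and c: "\<bar>c\<bar> \<le> 1"
      and hc: "\<And>x. x \<in> cube n \<Longrightarrow> \<bar>(h x - glauber n \<tau> h x) - (f x - c)\<bar> \<le> 1 / real n"
    proof (rule approx_poisson_solution[of \<tau> \<kappa> n "2 * real k / real n" f "1 / real n" 1])
      show "\<bar>\<tau> a\<bar> \<le> 1" for a
        by (simp add: \<tau>_def abs_clamped_response_le_1)
      show "\<bar>\<tau> a - \<tau> b\<bar> \<le> \<kappa> * \<bar>a - b\<bar>" for a b
        unfolding \<tau>_def \<kappa>_def using \<beta> m by (intro clamped_response_lipschitz) auto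
    qed (use f n \<kappa> K_def in auto)
    show "\<exists>c. \<forall>J. near_curie_weiss n \<beta> (\<beta> * (\<epsilon> + 1 / real n)) J
          \<longrightarrow> \<bar>gibbs_avg n J f - c\<bar> \<le> real k * C * (\<epsilon> + 1 / real n)"
    proof (intro exI[of _ c] allI impI)
      fix J assume "near_curie_weiss n \<beta> (\<beta> * (\<epsilon> + 1 / real n)) J"
      then interpret near_curie_weiss n \<beta> "\<beta> * (\<epsilon> + 1 / real n)" J .
      define u where "u = \<epsilon> + 1 / real n"
      have u: "1 / real n \<le> u" "u > 0"
        using \<epsilon> n by (auto simp: u_def add_pos_pos)
      define P where "P = gibbs_avg n J (\<lambda>x. of_bool (\<bar>mag n x\<bar> < m\<^sub>1))"
      have "P \<le> (2 * real n + 1) * exp (real n * (\<beta> * (\<epsilon> + 1 / real n))) * (tilt \<beta> m\<^sub>1 / tilt \<beta> m\<^sub>2) ^ n"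
        unfolding P_def using m by (intro small_mag_unlikely[OF inc]) auto
      also have "(tilt \<beta> m\<^sub>1 / tilt \<beta> m\<^sub>2) ^ n = exp (real n * (- \<Gamma>))"
        unfolding q by (rule exp_of_nat_mult[symmetric])
      also have "(2 * real n + 1) * exp (real n * (\<beta> * (\<epsilon> + 1 / real n))) * exp (real n * (- \<Gamma>))
          = (2 * real n + 1) * exp (real n * (\<beta> * (\<epsilon> + 1 / real n)) + real n * (- \<Gamma>))"
        by (simp only: exp_add mult.assoc)
      also have "\<dots> \<le> (2 * real n + 1) * exp (\<beta> + - (\<Gamma> * real n / 2))"
      proof -
        have "\<beta> * \<epsilon> \<le> \<Gamma> / 2"
          using \<epsilon> \<beta> by (simp add: field_simps)
        then have "real n * (\<beta> * \<epsilon>) \<le> real n * (\<Gamma> / 2)"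
          by (intro mult_left_mono) auto
        moreover have "real n * (\<beta> * (\<epsilon> + 1 / real n)) = real n * (\<beta> * \<epsilon>) + \<beta>"
          using n by (simp add: field_simps)
        ultimately show ?thesis
          by (simp add: mult.commute)
      qed
      also have "\<dots> = exp \<beta> * ((2 * real n + 1) * exp (- (\<Gamma> * real n / 2)))"
        by (simp only: exp_add mult_ac)
      also have "\<dots> \<le> exp \<beta> * (24 / \<Gamma> ^ 2 / real n)"
        using linear_exp_decay[OF \<open>\<Gamma> > 0\<close> n] by (intro mult_left_mono) auto
      also have "\<dots> = exp \<beta> * (24 / \<Gamma> ^ 2) * (1 / real n)"
        by simp
      also have "\<dots> \<le> exp \<beta> * (24 / \<Gamma> ^ 2) * u"
        using u by (intro mult_left_mono) auto
      finally have P: "P \<le> exp \<beta> * (24 / \<Gamma> ^ 2) * u" .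
      have "1 / ((m\<^sub>1 - m\<^sub>0) * real n) = 1 / (m\<^sub>1 - m\<^sub>0) * (1 / real n)"
        by simp
      also have "\<dots> \<le> 1 / (m\<^sub>1 - m\<^sub>0) * u"
        using u m by (intro mult_left_mono) auto
      finally have "1 / ((m\<^sub>1 - m\<^sub>0) * real n) + \<beta> * u / 2 \<le> (1 / (m\<^sub>1 - m\<^sub>0) + \<beta> / 2) * u"
        by (simp add: distrib_right)
      moreover have "K \<ge> 0"
        using \<kappa> by (simp add: K)
      ultimately have "2 * K * (1 / ((m\<^sub>1 - m\<^sub>0) * real n) + \<beta> * u / 2)
          \<le> 2 * K * ((1 / (m\<^sub>1 - m\<^sub>0) + \<beta> / 2) * u)"
        by (intro mult_left_mono) auto
      also have "\<dots> = real k * (4 / (1 - \<kappa>) * (1 / (m\<^sub>1 - m\<^sub>0) + \<beta> / 2) * u)"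
        by (simp add: K)
      finally have main: "2 * K * (1 / ((m\<^sub>1 - m\<^sub>0) * real n) + \<beta> * u / 2) \<le> \<dots>" .
      have "\<bar>gibbs_avg n J f - c\<bar>
          \<le> 2 * K * (1 / ((m\<^sub>1 - m\<^sub>0) * real n) + \<beta> * u / 2) + 2 * (1 / real n) + 2 * P"
        unfolding P_def u_def
        by (rule even_avg_near_const[OF m(1,2) f(1,2) h \<open>K \<ge> 0\<close> c hc[unfolded \<tau>_def]])
      also have "\<dots> \<le> real k * (4 / (1 - \<kappa>) * (1 / (m\<^sub>1 - m\<^sub>0) + \<beta> / 2) * u)
          + (2 * u + 2 * (exp \<beta> * (24 / \<Gamma> ^ 2) * u))"
        using main P u by linarith
      \<comment> \<open>As \<open>k \<ge> 1\<close>, the terms that do not grow with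
        \<open>k\<close> can take the factor \<open>k\<close> as well.\<close>
      also have "2 * u + 2 * (exp \<beta> * (24 / \<Gamma> ^ 2) * u) \<le> real k * (2 * u + 2 * (exp \<beta> * (24 / \<Gamma> ^ 2) * u))"
      proof -
        have "1 * (2 * u + 2 * (exp \<beta> * (24 / \<Gamma> ^ 2) * u)) \<le> real k * (2 * u + 2 * (exp \<beta> * (24 / \<Gamma> ^ 2) * u))"
          using k u by (intro mult_right_mono) auto
        then show ?thesis by simp
      qed
      finally show "\<bar>gibbs_avg n J f - c\<bar> \<le> real k * C * (\<epsilon> + 1 / real n)"
        unfolding C_def u_def[symmetric] by (simp add: algebra_simps)
    qed
  qed
qed


section \<open>Comparison of the two models\<close>

text \<open>The bridge from the measure on vectors to finite sums over the function cube, where all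
  estimates live.\<close>

lemma expectation_ising:
  assumes M: "M \<in> carrier_mat n n"
  shows "measure_pmf.expectation (ising M) F = gibbs_avg n (\<lambda>i j. M $$ (i, j)) (\<lambda>x. F (Matrix.vec n x))"
proof -
  let ?J = "\<lambda>i j. M $$ (i, j)"
  have reindex: "(\<Sum>v\<in>spins n. g v) = (\<Sum>x\<in>cube n. g (Matrix.vec n x))" for g :: "real vec \<Rightarrow> real"
    by (rule sum.reindex_bij_witness[of _ "Matrix.vec n" "\<lambda>v. restrict (\<lambda>i. v $ i) {..<n}"])
       (auto simp: spins_def cube_def PiE_iff extensional_def fun_eq_iff intro!: arg_cong[where f = g] eq_vecI)
  have weight: "ising_weight M (Matrix.vec n x) = exp (energy n ?J x)" for x
    using M by (simp add: ising_weight_def energy_def local_field_def scalar_prod_def lessThan_atLeast0)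
  have in_spins: "Matrix.vec n x \<in> spins n" if "x \<in> cube n" for x
    using that by (auto simp: spins_def cube_def)
  have pmf: "pmf (ising M) (Matrix.vec n x) = gibbs_prob n ?J x" if "x \<in> cube n" for x
    using M in_spins[OF that] by (simp add: pmf_ising reindex weight gibbs_prob_def)
  have "measure_pmf.expectation (ising M) F = (\<Sum>v\<in>spins n. pmf (ising M) v *\<^sub>R F v)"
    using M by (intro integral_measure_pmf finite_spins) (auto simp: set_pmf_iff pmf_ising split: if_splits)
  also have "\<dots> = gibbs_avg n ?J (\<lambda>x. F (Matrix.vec n x))"
    unfolding reindex gibbs_avg_def by (intro sum.cong) (auto simp: pmf)
  finally show ?thesis .
qed

lemma moment_ising:
  assumes "M \<in> carrier_mat n n" "R \<subseteq> {..<n}"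
  shows "moment (ising M) R = gibbs_avg n (\<lambda>i j. M $$ (i, j)) (\<lambda>x. \<Prod>i\<in>R. x i)"
  unfolding moment_def expectation_ising[OF assms(1)]
  by (intro gibbs_avg_cong prod.cong refl) (use assms(2) in auto)

text \<open>The division by \<open>n\<close> in the cavity magnetization makes the discrepancy
  vanish, so this model can be given the same \<eta> as the expander.\<close>

lemma near_curie_weiss_complete_graph:
  assumes "n > 0" "\<beta> > 0" "\<eta> \<ge> 0"
  shows "near_curie_weiss n \<beta> \<eta> (\<lambda>i j. (\<beta> / real n \<cdot>\<^sub>m adjacency_mat n (complete_graph n)) $$ (i, j))"
    (is "near_curie_weiss n \<beta> \<eta> ?J")
proof
  have J: "?J i j = \<beta> / real n * of_bool (i \<noteq> j)" if "i < n" "j < n" for i j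
    using that by (auto simp: adjacency_mat_def complete_graph_def card_2_iff)
  show "?J i j = ?J j i" if "i < n" "j < n" for i j
    using that by (simp add: J)
  show "?J i i = 0" if "i < n" for i
    using that by (simp add: J)
  fix x
  have "local_field n ?J x i = \<beta> * cavity_mag n x i" if i: "i < n" for i
  proof -
    have "local_field n ?J x i = (\<Sum>j<n. \<beta> / real n * (of_bool (i \<noteq> j) * x j))"
      unfolding local_field_def using i by (intro sum.cong) (auto simp: J)
    also have "\<dots> = \<beta> / real n * (\<Sum>j\<in>{..<n} - {i}. x j)"
      unfolding sum_distrib_left[symmetric]
      by (intro arg_cong2[of _ _ _ _ "(*)"] sum.mono_neutral_cong_right) auto
    finally show ?thesis
      by (simp add: cavity_mag_def)
  qed
  then show "(\<Sum>i<n. \<bar>local_field n ?J x i - \<beta> * cavity_mag n x i\<bar>) \<le> real n * \<eta>"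
    using assms by simp
qed (use assms in auto)

lemma regular_graph_row_sum:
  assumes "regular_graph n d G" "i < n"
  shows "(\<Sum>j<n. of_bool ({i, j} \<in> G)) = real d"
proof -
  have G: "e \<subseteq> {..<n}" "card e = 2" if "e \<in> G" for e
    using that assms(1) by (auto simp: regular_graph_def simple_graph_def complete_graph_def)
  have "bij_betw (\<lambda>j. {i, j}) {j. j < n \<and> {i, j} \<in> G} {e \<in> G. i \<in> e}"
    unfolding bij_betw_def
  proof
    show "inj_on (\<lambda>j. {i, j}) {j. j < n \<and> {i, j} \<in> G}"
      by (auto simp: inj_on_def doubleton_eq_iff)
    show "(\<lambda>j. {i, j}) ` {j. j < n \<and> {i, j} \<in> G} = {e \<in> G. i \<in> e}"
    proof (intro equalityI subsetI)
      fix e assume e: "e \<in> {e \<in> G. i \<in> e}"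
      then obtain j where "e = {i, j}"
        using G(2)[of e] by (auto simp: card_2_iff)
      then show "e \<in> (\<lambda>j. {i, j}) ` {j. j < n \<and> {i, j} \<in> G}"
        using e G(1)[of e] by auto
    qed auto
  qed
  then have "card {j. j < n \<and> {i, j} \<in> G} = d"
    using assms by (auto simp: regular_graph_def dest!: bij_betw_same_card)
  moreover have "{..<n} \<inter> {j. {i, j} \<in> G} = {j. j < n \<and> {i, j} \<in> G}"
    by auto
  ultimately show ?thesis
    by simp
qed

lemma expander_norm_bound:
  assumes G: "expander n d \<epsilon> G" and y: "(\<Sum>i<n. y i) = 0"
  shows "(\<Sum>i<n. local_field n (\<lambda>i j. of_bool ({i, j} \<in> G)) y i ^ 2) \<le> (\<epsilon> * real d) ^ 2 * (\<Sum>i<n. y i ^ 2)"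
proof (rule norm_bound_orthogonal_to_ones[OF _ _ _ y])
  let ?B = "\<lambda>i j. of_bool ({i, j} \<in> G) :: real"
  show "?B i j = ?B j i" for i j
    by (simp add: insert_commute)
  show "(\<Sum>j<n. ?B i j) = real d" if "i < n" for i
    using G that by (intro regular_graph_row_sum) (auto simp: expander_def)
  fix l and v :: "nat \<Rightarrow> real"
  assume v: "\<exists>i<n. v i \<noteq> 0" "(\<Sum>i<n. v i) = 0" and ev: "\<And>i. i < n \<Longrightarrow> local_field n ?B v i = l * v i"
  let ?v = "Matrix.vec n v"
  have "adjacency_mat n G *\<^sub>v ?v = l \<cdot>\<^sub>v ?v"
  proof (rule eq_vecI)
    show "(adjacency_mat n G *\<^sub>v ?v) $ i = (l \<cdot>\<^sub>v ?v) $ i" if "i < dim_vec (l \<cdot>\<^sub>v ?v)" for i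
      using that ev[of i]
      by (simp add: adjacency_mat_def scalar_prod_def local_field_def lessThan_atLeast0)
  qed (simp add: adjacency_mat_def)
  moreover have "?v \<noteq> 0\<^sub>v n"
    using v(1) by (metis index_vec index_zero_vec(1))
  ultimately have "eigenvector (adjacency_mat n G) ?v l"
    by (simp add: eigenvector_def adjacency_mat_def)
  moreover have "?v \<bullet> Matrix.vec n (\<lambda>_. 1) = 0"
    using v(2) by (simp add: scalar_prod_def lessThan_atLeast0)
  ultimately show "\<bar>l\<bar> \<le> \<epsilon> * real d"
    using G by (auto simp: expander_def)
qed

text \<open>Split \<open>x\<close> into its mean and a part \<open>y\<close> orthogonal to the ones.
  Regularity sends the mean to the field \<open>\<beta> * M\<close>, the spectral gap bounds the
  field of \<open>y\<close> by \<epsilon> on average, and passing from \<open>M\<close> to the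
  cavity magnetization costs \<open>\<beta> / n\<close> per vertex.\<close>

lemma near_curie_weiss_expander:
  assumes n: "n > 0" and \<beta>: "\<beta> > 0" and d: "d > 0" and G: "expander n d \<epsilon> G"
  shows "near_curie_weiss n \<beta> (\<beta> * (\<epsilon> + 1 / real n)) (\<lambda>i j. (\<beta> / real d \<cdot>\<^sub>m adjacency_mat n G) $$ (i, j))"
    (is "near_curie_weiss n \<beta> _ ?J")
proof
  let ?B = "\<lambda>i j. of_bool ({i, j} \<in> G) :: real"
  have reg: "regular_graph n d G" and \<epsilon>: "\<epsilon> > 0"
    using G by (auto simp: expander_def)
  have J: "?J i j = \<beta> / real d * ?B i j" if "i < n" "j < n" for i j
    using that by (auto simp: adjacency_mat_def)
  show "?J i j = ?J j i" if "i < n" "j < n" for i j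
    using that by (simp only: J insert_commute)
  have "{i} \<notin> G" for i
    using reg by (auto simp: regular_graph_def simple_graph_def complete_graph_def)
  then show "?J i i = 0" if "i < n" for i
    using that by (simp add: J)
  fix x assume x: "x \<in> cube n"
  define y where "y = (\<lambda>i. x i + (- mag n x) * 1)"
  have sum_y: "(\<Sum>i<n. y i) = 0"
    using n by (simp add: y_def sum_subtractf mag_def)
  have "(\<Sum>i<n. y i ^ 2) = (\<Sum>i<n. x i * x i) - real n * mag n x ^ 2"
  proof -
    have "(\<Sum>i<n. y i ^ 2) = (\<Sum>i<n. x i * x i - 2 * mag n x * x i + mag n x ^ 2)"
      by (intro sum.cong) (auto simp: y_def power2_eq_square algebra_simps)
    also have "\<dots> = (\<Sum>i<n. x i * x i) - 2 * mag n x * (\<Sum>i<n. x i) + real n * mag n x ^ 2"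
      by (simp add: sum.distrib sum_subtractf sum_distrib_left)
    also have "(\<Sum>i<n. x i) = real n * mag n x"
      using n by (simp add: mag_def)
    finally show ?thesis
      by (simp add: power2_eq_square)
  qed
  also have "(\<Sum>i<n. x i * x i) = real n"
    using x by (simp add: cube_square)
  finally have norm_y: "(\<Sum>i<n. y i ^ 2) \<le> real n"
    by simp
  have field: "local_field n ?J x i = \<beta> * mag n x + \<beta> / real d * local_field n ?B y i" if i: "i < n" for i
  proof -
    have "local_field n ?B y i = local_field n ?B x i + (- mag n x) * local_field n ?B (\<lambda>_. 1) i"
      unfolding y_def by (rule local_field_lincomb)
    also have "local_field n ?B (\<lambda>_. 1) i = real d"
      using regular_graph_row_sum[OF reg i] by (simp add: local_field_def)
    finally have "local_field n ?B x i = real d * mag n x + local_field n ?B y i"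
      by simp
    moreover have "local_field n ?J x i = (\<Sum>j<n. \<beta> / real d * (?B i j * x j))"
      unfolding local_field_def using i by (intro sum.cong) (auto simp: J)
    then have "local_field n ?J x i = \<beta> / real d * local_field n ?B x i"
      unfolding local_field_def sum_distrib_left .
    ultimately show ?thesis
      using d by (simp add: distrib_left)
  qed
  \<comment> \<open>Cauchy-Schwarz converts the Euclidean bound into the averaged one.\<close>
  have "(\<Sum>i<n. \<bar>local_field n ?B y i\<bar>)\<^sup>2 \<le> (\<Sum>i<n. \<bar>local_field n ?B y i\<bar>\<^sup>2) * real (card {..<n})"
    by (rule sum_squared_le_sum_of_squares)
  also have "\<dots> \<le> ((\<epsilon> * real d)\<^sup>2 * real n) * real n"
  proof -
    have "(\<Sum>i<n. \<bar>local_field n ?B y i\<bar>\<^sup>2) \<le> (\<epsilon> * real d)\<^sup>2 * (\<Sum>i<n. y i ^ 2)"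
      using expander_norm_bound[OF G sum_y] by simp
    also have "\<dots> \<le> (\<epsilon> * real d)\<^sup>2 * real n"
      using norm_y by (intro mult_left_mono) auto
    finally show ?thesis
      by (simp add: mult_right_mono)
  qed
  also have "\<dots> = (real n * \<epsilon> * real d)\<^sup>2"
    by (simp add: power2_eq_square)
  finally have l1: "(\<Sum>i<n. \<bar>local_field n ?B y i\<bar>) \<le> real n * \<epsilon> * real d"
    using \<epsilon> by (rule_tac power2_le_imp_le) auto
  have "(\<Sum>i<n. \<bar>local_field n ?J x i - \<beta> * cavity_mag n x i\<bar>)
      \<le> (\<Sum>i<n. \<beta> / real d * \<bar>local_field n ?B y i\<bar> + \<beta> / real n)"
  proof (rule sum_mono)
    fix i assume "i \<in> {..<n}"
    then have i: "i < n" by simp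
    have "local_field n ?J x i - \<beta> * cavity_mag n x i
        = \<beta> / real d * local_field n ?B y i + \<beta> * (x i / real n)"
      unfolding field[OF i] cavity_mag_eq[OF i] by (simp add: right_diff_distrib)
    also have "\<bar>\<dots>\<bar> \<le> \<bar>\<beta> / real d * local_field n ?B y i\<bar> + \<bar>\<beta> * (x i / real n)\<bar>"
      by (rule abs_triangle_ineq)
    also have "\<dots> = \<beta> / real d * \<bar>local_field n ?B y i\<bar> + \<beta> / real n"
      using \<beta> x i by (simp add: abs_mult)
    finally show "\<bar>local_field n ?J x i - \<beta> * cavity_mag n x i\<bar> \<le> \<dots>" .
  qed
  also have "\<dots> = \<beta> / real d * (\<Sum>i<n. \<bar>local_field n ?B y i\<bar>) + \<beta>"
    using n by (simp add: sum.distrib sum_distrib_left)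
  also have "\<dots> \<le> \<beta> / real d * (real n * \<epsilon> * real d) + \<beta>"
    using l1 \<beta> by (intro add_right_mono mult_left_mono) auto
  also have "\<dots> = real n * (\<beta> * (\<epsilon> + 1 / real n))"
    using d n by (simp add: field_simps)
  finally show "(\<Sum>i<n. \<bar>local_field n ?J x i - \<beta> * cavity_mag n x i\<bar>) \<le> \<dots>" .
qed (use n \<beta> in auto)

lemma sum_pairs_eq_sum_2_subsets:
  "(\<Sum>(i, j) | i < j \<and> j < n. F {i, j}) = (\<Sum>R | R \<subseteq> {..<n::nat} \<and> card R = 2. F R)"
proof (rule sum.reindex_bij_witness[of _ "\<lambda>R. (Min R, Max R)" "\<lambda>(i, j). {i, j}"])
  fix R assume R: "R \<in> {R. R \<subseteq> {..<n} \<and> card R = 2}"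
  then obtain a b where ab: "R = {a, b}" "a \<noteq> b"
    by (auto simp: card_2_iff)
  show "(Min R, Max R) \<in> {(i, j). i < j \<and> j < n}"
    using R ab by auto
  show "(case (Min R, Max R) of (i, j) \<Rightarrow> {i, j}) = R"
    using ab by (auto simp: min_def max_def)
qed auto

theorem theorem4p4:
  fixes \<beta> :: real
  assumes "\<beta> > 1"
  shows "\<exists>\<epsilon>\<^sub>0>0. \<exists>C>0. \<forall>(n::nat) (d::nat) (\<epsilon>::real) (G::nat set set).
    d > 0 \<and> expander n d \<epsilon> G \<and> \<epsilon> < \<epsilon>\<^sub>0 \<longrightarrow>
    (let \<mu> = ising ((\<beta> / real n) \<cdot>\<^sub>m adjacency_mat n (complete_graph n));
         \<nu> = ising ((\<beta> / real d) \<cdot>\<^sub>m adjacency_mat n G)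
     in (\<forall>k::nat. even k \<and> 0 < k \<and> k < n \<longrightarrow>
           1 / real (n choose k) * (\<Sum>R | R \<subseteq> {..<n} \<and> card R = k. \<bar>moment \<mu> R - moment \<nu> R\<bar>)
             \<le> real k * C * (\<epsilon> + 1 / real n)) \<and>
        (n \<ge> 2 \<longrightarrow>
           1 / real (n choose 2) * (\<Sum>(i, j) | i < j \<and> j < n.
               \<bar>measure_pmf.expectation \<mu> (\<lambda>x. x $ i * x $ j) -
                measure_pmf.expectation \<nu> (\<lambda>x. x $ i * x $ j)\<bar>)
             < 2 * C * (\<epsilon> + 1 / real n)))"
proof -
  obtain \<epsilon>\<^sub>0 C where \<epsilon>0: "\<epsilon>\<^sub>0 > 0" and C: "C > 0" and universal:
    "\<And>n \<epsilon> k f. \<lbrakk>n > 0; 0 < \<epsilon>; \<epsilon> < \<epsilon>\<^sub>0; 0 < k; \<And>x. x \<in> cube n \<Longrightarrow> f (flip_all n x) = f x;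
        \<And>x. x \<in> cube n \<Longrightarrow> \<bar>f x\<bar> \<le> 1; lipschitz_coord n (2 * real k / real n) f\<rbrakk>
      \<Longrightarrow> \<exists>c. \<forall>J. near_curie_weiss n \<beta> (\<beta> * (\<epsilon> + 1 / real n)) J
          \<longrightarrow> \<bar>gibbs_avg n J f - c\<bar> \<le> real k * C * (\<epsilon> + 1 / real n)"
    using even_avg_universal[OF assms] by blast
  show ?thesis
  \<comment> \<open>\<open>2 * C\<close> comes from the triangle inequality through
    \<open>c\<close>; the added 1 makes the bound for pairs strict.\<close>
  proof (rule exI[of _ \<epsilon>\<^sub>0], intro conjI \<epsilon>0, rule exI[of _ "2 * C + 1"], intro conjI allI impI)
    show "2 * C + 1 > 0" using C by simp
    fix n d :: nat and \<epsilon> :: real and G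
    assume asm: "d > 0 \<and> expander n d \<epsilon> G \<and> \<epsilon> < \<epsilon>\<^sub>0"
    define u where "u = \<epsilon> + 1 / real n"
    define M\<^sub>\<mu> where "M\<^sub>\<mu> = \<beta> / real n \<cdot>\<^sub>m adjacency_mat n (complete_graph n)"
    define M\<^sub>\<nu> where "M\<^sub>\<nu> = \<beta> / real d \<cdot>\<^sub>m adjacency_mat n G"
    define \<mu> where "\<mu> = ising M\<^sub>\<mu>"
    define \<nu> where "\<nu> = ising M\<^sub>\<nu>"
    have carrier: "M\<^sub>\<mu> \<in> carrier_mat n n" "M\<^sub>\<nu> \<in> carrier_mat n n"
      by (auto simp: M\<^sub>\<mu>_def M\<^sub>\<nu>_def adjacency_mat_def)
    have \<epsilon>: "0 < \<epsilon>"
      using asm by (simp add: expander_def)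
    then have u: "u > 0"
      by (simp add: u_def add_pos_nonneg)
    \<comment> \<open>Shown up to \<open>k = n\<close>, so that the claim on pairs also covers
      \<open>n = 2\<close>.\<close>
    have bound: "1 / real (n choose k) * (\<Sum>R | R \<subseteq> {..<n} \<and> card R = k. \<bar>moment \<mu> R - moment \<nu> R\<bar>)
        \<le> real k * (2 * C) * u" if k: "even k" "0 < k" "k \<le> n" for k
    proof -
      define \<sigma> where "\<sigma> = (\<lambda>R. sgn (moment \<mu> R - moment \<nu> R))"
      have \<sigma>: "\<bar>\<sigma> R\<bar> \<le> 1" for R
        by (simp add: \<sigma>_def abs_sgn_eq)
      have n: "n > 0"
        using k by simp
      \<comment> \<open>The signs depend on both measures, which is legitimate because
        \<open>f\<close> is arbitrary and the resulting \<open>c\<close> serves every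
        \<open>J\<close> at once.\<close>
      obtain c where c: "\<And>J. near_curie_weiss n \<beta> (\<beta> * (\<epsilon> + 1 / real n)) J
          \<Longrightarrow> \<bar>gibbs_avg n J (signed_moment_avg n k \<sigma>) - c\<bar> \<le> real k * C * u"
        using universal[OF n \<epsilon> _ k(2), of "signed_moment_avg n k \<sigma>"] asm
          signed_moment_avg_flip_all[OF k(1)] signed_moment_avg_le_1[where \<sigma> = \<sigma>, OF \<sigma> _ k(3)]
          signed_moment_avg_lipschitz[where \<sigma> = \<sigma>, OF \<sigma> k(2,3)]
        unfolding u_def by blast
      have avg: "gibbs_avg n (\<lambda>i j. M $$ (i, j)) (signed_moment_avg n k \<sigma>)
          = 1 / real (n choose k) * (\<Sum>R | R \<subseteq> {..<n} \<and> card R = k. \<sigma> R * moment (ising M) R)"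
        if "M \<in> carrier_mat n n" for M
        unfolding signed_moment_avg_def gibbs_avg_cmult gibbs_avg_sum
        by (intro arg_cong2[of _ _ _ _ "(*)"] sum.cong refl) (use moment_ising[OF that] in auto)
      have "1 / real (n choose k) * (\<Sum>R | R \<subseteq> {..<n} \<and> card R = k. \<bar>moment \<mu> R - moment \<nu> R\<bar>)
          = 1 / real (n choose k) * (\<Sum>R | R \<subseteq> {..<n} \<and> card R = k. \<sigma> R * moment \<mu> R - \<sigma> R * moment \<nu> R)"
        by (intro arg_cong2[of _ _ _ _ "(*)"] sum.cong refl) (simp add: \<sigma>_def sgn_if)
      also have "\<dots> = gibbs_avg n (\<lambda>i j. M\<^sub>\<mu> $$ (i, j)) (signed_moment_avg n k \<sigma>)
          - gibbs_avg n (\<lambda>i j. M\<^sub>\<nu> $$ (i, j)) (signed_moment_avg n k \<sigma>)"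
        unfolding avg[OF carrier(1)] avg[OF carrier(2)] \<mu>_def[symmetric] \<nu>_def[symmetric]
          sum_subtractf right_diff_distrib ..
      also have "\<dots> \<le> real k * C * u + real k * C * u"
      proof -
        have 1: "near_curie_weiss n \<beta> (\<beta> * (\<epsilon> + 1 / real n)) (\<lambda>i j. M\<^sub>\<mu> $$ (i, j))"
          unfolding M\<^sub>\<mu>_def using n assms u by (intro near_curie_weiss_complete_graph) (auto simp: u_def)
        have 2: "near_curie_weiss n \<beta> (\<beta> * (\<epsilon> + 1 / real n)) (\<lambda>i j. M\<^sub>\<nu> $$ (i, j))"
          unfolding M\<^sub>\<nu>_def using n assms asm by (intro near_curie_weiss_expander) auto
        show ?thesis
          using c[OF 1] c[OF 2] by linarith
      qed
      finally show ?thesis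
        by (simp add: mult_ac)
    qed
    have "1 / real (n choose k) * (\<Sum>R | R \<subseteq> {..<n} \<and> card R = k. \<bar>moment \<mu> R - moment \<nu> R\<bar>)
        \<le> real k * (2 * C + 1) * u" if "even k \<and> 0 < k \<and> k < n" for k
    proof (rule order_trans[OF bound])
      show "real k * (2 * C) * u \<le> real k * (2 * C + 1) * u"
        using u by (intro mult_right_mono mult_left_mono) auto
    qed (use that in auto)
    moreover have "1 / real (n choose 2) * (\<Sum>(i, j) | i < j \<and> j < n.
               \<bar>measure_pmf.expectation \<mu> (\<lambda>x. x $ i * x $ j) -
                measure_pmf.expectation \<nu> (\<lambda>x. x $ i * x $ j)\<bar>) < 2 * (2 * C + 1) * u" if "n \<ge> 2"
    proof -
      have "(\<Sum>(i, j) | i < j \<and> j < n. \<bar>measure_pmf.expectation \<mu> (\<lambda>x. x $ i * x $ j) -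
                measure_pmf.expectation \<nu> (\<lambda>x. x $ i * x $ j)\<bar>)
          = (\<Sum>(i, j) | i < j \<and> j < n. \<bar>moment \<mu> {i, j} - moment \<nu> {i, j}\<bar>)"
        by (intro sum.cong) (auto simp: moment_def)
      also have "\<dots> = (\<Sum>R | R \<subseteq> {..<n} \<and> card R = 2. \<bar>moment \<mu> R - moment \<nu> R\<bar>)"
        by (rule sum_pairs_eq_sum_2_subsets)
      finally show ?thesis
        using bound[of 2] that u by (simp add: algebra_simps)
    qed
    ultimately show "let \<mu> = ising ((\<beta> / real n) \<cdot>\<^sub>m adjacency_mat n (complete_graph n));
         \<nu> = ising ((\<beta> / real d) \<cdot>\<^sub>m adjacency_mat n G)
     in (\<forall>k::nat. even k \<and> 0 < k \<and> k < n \<longrightarrow>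
           1 / real (n choose k) * (\<Sum>R | R \<subseteq> {..<n} \<and> card R = k. \<bar>moment \<mu> R - moment \<nu> R\<bar>)
             \<le> real k * (2 * C + 1) * (\<epsilon> + 1 / real n)) \<and>
        (n \<ge> 2 \<longrightarrow>
           1 / real (n choose 2) * (\<Sum>(i, j) | i < j \<and> j < n.
               \<bar>measure_pmf.expectation \<mu> (\<lambda>x. x $ i * x $ j) -
                measure_pmf.expectation \<nu> (\<lambda>x. x $ i * x $ j)\<bar>)
             < 2 * (2 * C + 1) * (\<epsilon> + 1 / real n))"
      unfolding Let_def M\<^sub>\<mu>_def[symmetric] M\<^sub>\<nu>_def[symmetric] \<mu>_def[symmetric] \<nu>_def[symmetric] u_def[symmetric]
      by blast
  qed
qed

end
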